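(* The quintuple $(H_{\rm RT}(X,\Omega),\,m_{\rm RT},\,1,\,\Delta_{\rm RT},\,\varepsilon_{\rm RT})$, equipped with the filtration $\{H_{{\rm RT},(n)}\}_{n\ge 0}$ by number of vertices, is a connected cofiltered coaugmented coalgebra (with coaugmentation $u:\mathbf{k}\to H_{\rm RT}(X,\Omega)$, $c\mapsto c\,1$), and consequently is a Hopf algebra.
   Context: Let $\mathbf{k}$ be a unitary commutative ring, $X$ a set, $\Omega$ a nonempty set disjoint from $X$, and fix maps $\mu:X\to\mathbf{k}$, $x\mapsto\mu_x$, and $\lambda:\Omega\to\mathbf{k}$, $\omega\mapsto\lambda_\omega$. Decorated forests. An $(X,\Omega)$-decorated rooted tree is a (nonempty) planar rooted tree whose internal (non-leaf) vertices are decorated by elements of $\Omega$ and whose leaf vertices are decorated by elements of $X\sqcup\Omega$; the only vertex of a one-vertex tree is regarded as a leaf. $\mathcal{T}_{\rm RT}(X,\Omega)$ is the set of such trees, and $\mathcal{F}_{\rm RT}(X,\Omega)$ (the forests) is the free monoid on $\mathcal{T}_{\rm RT}(X,\Omega)$ under concatenation, with unit the empty forest $1$. $H_{\rm RT}(X,\Omega)=\mathbf{k}\mathcal{F}_{\rm RT}(X,\Omega)$ is the free $\mathbf{k}$-module on the forests, a unitary associative algebra under the concatenation product $m_{\rm RT}$. For $a\in X\sqcup\Omega$, $\bullet_a$ is the one-vertex tree decorated by $a$. For $\omega\in\Omega$, $B^+_\omega:H_{\rm RT}(X,\Omega)\to H_{\rm RT}(X,\Omega)$ is the linear grafting operator: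 $B^+_\omega(1)=\bullet_\omega$, and $B^+_\omega(T_1\cdots T_n)$ is the tree obtained by joining the roots of $T_1,\dots,T_n$ (in order) to a new root decorated by $\omega$. Every tree is uniquely either $\bullet_x$ with $x\in X$ or $B^+_\omega(\overline{F})$ with $\omega\in\Omega$, $\overline{F}$ a forest. Coproduct. The linear map $\Delta_{\rm RT}:H_{\rm RT}(X,\Omega)\to H_{\rm RT}(X,\Omega)\otimes H_{\rm RT}(X,\Omega)$ is defined recursively by $\Delta_{\rm RT}(1)=1\otimes 1$; $\Delta_{\rm RT}(\bullet_x)=\bullet_x\otimes 1+1\otimes\bullet_x+\mu_x\,1\otimes 1$ for $x\in X$; $\Delta_{\rm RT}(B^+_\omega(\overline{F}))=B^+_\omega(\overline{F})\otimes 1+(\mathrm{id}\otimes B^+_\omega)\Delta_{\rm RT}(\overline{F})+\lambda_\omega\overline{F}\otimes 1$; and $\Delta_{\rm RT}(T_1\cdots T_m)=\Delta_{\rm RT}(T_1)\cdots\Delta_{\rm RT}(T_m)$ for $m\ge 2$ trees. Counit. The linear map $\varepsilon_{\rm RT}:H_{\rm RT}(X,\Omega)\to\mathbf{k}$ is defined recursively by $\varepsilon_{\rm RT}(1)=1_{\mathbf{k}}$; $\varepsilon_{\rm RT}(\bullet_x)=-\mu_x$ for $x\in X$; $\varepsilon_{\rm RT}(B^+_\omega(\overline{F}))=-\lambda_\omega\varepsilon_{\rm RT}(\overline{F})$; and $\varepsilon_{\rm RT}(T_1\cdots T_m)=\varepsilon_{\rm RT}(T_1)\cdots\varepsilon_{\rm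 RT}(T_m)$ for $m\ge 2$ trees. Filtration. For $k\ge 0$ let $H_{\rm RT}^{(k)}$ be the $\mathbf{k}$-span of the forests in $\mathcal{F}_{\rm RT}(X,\Omega)$ with exactly $k$ vertices, and $H_{{\rm RT},(n)}:=\bigoplus_{k\le n}H_{\rm RT}^{(k)}$. Connected cofiltered coaugmented coalgebras. A coalgebra $(C,\Delta,\varepsilon)$ is coaugmented if there is a linear map $u:\mathbf{k}\to C$ (the coaugmentation) with $\varepsilon u=\mathrm{id}_{\mathbf{k}}$. A coaugmented coalgebra $(C,u,\Delta,\varepsilon)$ is cofiltered if there is an exhaustive increasing filtration $\{C_{(n)}\}_{n\ge 0}$ of $C$ such that $\mathrm{im}\,u\subseteq C_{(n)}$ and $\Delta(C_{(n)})\subseteq\sum_{p+q=n,\ p,q\ge 0}C_{(p)}\otimes C_{(q)}$ for all $n\ge 0$. It is connected if in addition $C_{(0)}=\mathrm{im}\,u$. *)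

theory Defs
  imports Complex_Main "HOL-Library.Poly_Mapping" "HOL-Library.Product_Plus"
begin

section \<open>Free modules, linear maps and tensor products\<close>

text \<open>
  The free module on a set \<open>S\<close> consists of the finitely supported functions
  \<open>'b \<Rightarrow>\<^sub>0 'k\<close> with support in \<open>S\<close>. The basis is a set, not a type, so that it may depend on
  term parameters and may be empty. Maps between such modules are functions on the whole
  type of which only the values on the free module matter.
\<close>

definition free_mod :: "'b set \<Rightarrow> ('b \<Rightarrow>\<^sub>0 'k::comm_ring_1) set"
  where "free_mod S = {p. Poly_Mapping.keys p \<subseteq> S}"

abbreviation basis :: "'b \<Rightarrow> ('b \<Rightarrow>\<^sub>0 'k::comm_ring_1)"
  where "basis b \<equiv> Poly_Mapping.single b 1"

definition smult :: "'k::comm_ring_1 \<Rightarrow> ('b \<Rightarrow>\<^sub>0 'k) \<Rightarrow> ('b \<Rightarrow>\<^sub>0 'k)"  (infixr \<open>\<odot>\<close> 74)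
  where "c \<odot> p = Poly_Mapping.map ((*) c) p"

definition linear_map ::
    "('k::comm_ring_1 \<Rightarrow> 'm::ab_group_add \<Rightarrow> 'm) \<Rightarrow> ('k \<Rightarrow> 'n::ab_group_add \<Rightarrow> 'n) \<Rightarrow>
     'm set \<Rightarrow> 'n set \<Rightarrow> ('m \<Rightarrow> 'n) \<Rightarrow> bool"
  where "linear_map s t V W f \<longleftrightarrow>
    f ` V \<subseteq> W \<and> (\<forall>x\<in>V. \<forall>y\<in>V. f (x + y) = f x + f y) \<and> (\<forall>c. \<forall>x\<in>V. f (s c x) = t c (f x))"

definition lin_ext ::
    "('k::comm_ring_1 \<Rightarrow> 'm::ab_group_add \<Rightarrow> 'm) \<Rightarrow> ('b \<Rightarrow> 'm) \<Rightarrow> ('b \<Rightarrow>\<^sub>0 'k) \<Rightarrow> 'm"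
  where "lin_ext s f p = (\<Sum>b\<in>Poly_Mapping.keys p. s (Poly_Mapping.lookup p b) (f b))"

text \<open>
  The tensor product of the free modules on \<open>S\<close> and \<open>T\<close> is the free module on \<open>S \<times> T\<close>,
  with the pure tensors below; its universal property is proved in \<open>tensor_lift_linear\<close>,
  \<open>tensor_lift_tensor\<close> and \<open>tensor_lift_unique\<close>.
\<close>

definition tensor ::
    "('b \<Rightarrow>\<^sub>0 'k::comm_ring_1) \<Rightarrow> ('c \<Rightarrow>\<^sub>0 'k) \<Rightarrow> ('b \<times> 'c \<Rightarrow>\<^sub>0 'k)"  (infixr \<open>\<otimes>\<close> 76)
  where "p \<otimes> q = (\<Sum>a\<in>Poly_Mapping.keys p. \<Sum>b\<in>Poly_Mapping.keys q.
    Poly_Mapping.single (a, b) (Poly_Mapping.lookup p a * Poly_Mapping.lookup q b))"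

definition tensor_lift ::
    "('k::comm_ring_1 \<Rightarrow> 'm::ab_group_add \<Rightarrow> 'm) \<Rightarrow>
     (('b \<Rightarrow>\<^sub>0 'k) \<Rightarrow> ('c \<Rightarrow>\<^sub>0 'k) \<Rightarrow> 'm) \<Rightarrow> ('b \<times> 'c \<Rightarrow>\<^sub>0 'k) \<Rightarrow> 'm"
  where "tensor_lift s \<phi> = lin_ext s (\<lambda>(a, b). \<phi> (basis a) (basis b))"

definition tensor_map ::
    "(('b \<Rightarrow>\<^sub>0 'k::comm_ring_1) \<Rightarrow> ('d \<Rightarrow>\<^sub>0 'k)) \<Rightarrow> (('c \<Rightarrow>\<^sub>0 'k) \<Rightarrow> ('e \<Rightarrow>\<^sub>0 'k)) \<Rightarrow>
     ('b \<times> 'c \<Rightarrow>\<^sub>0 'k) \<Rightarrow> ('d \<times> 'e \<Rightarrow>\<^sub>0 'k)"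
  where "tensor_map f g = tensor_lift (\<odot>) (\<lambda>x y. f x \<otimes> g y)"

definition tensor_assoc :: "(('b \<times> 'c) \<times> 'd \<Rightarrow>\<^sub>0 'k::comm_ring_1) \<Rightarrow> ('b \<times> 'c \<times> 'd \<Rightarrow>\<^sub>0 'k)"
  where "tensor_assoc = lin_ext (\<odot>) (\<lambda>((a, b), c). basis (a, b, c))"

text \<open>\<open>(a \<otimes> b) (c \<otimes> d) = m a c \<otimes> m b d\<close>, extended bilinearly.\<close>

definition tensor_times ::
    "(('b \<Rightarrow>\<^sub>0 'k::comm_ring_1) \<Rightarrow> ('b \<Rightarrow>\<^sub>0 'k) \<Rightarrow> ('b \<Rightarrow>\<^sub>0 'k)) \<Rightarrow>
     ('b \<times> 'b \<Rightarrow>\<^sub>0 'k) \<Rightarrow> ('b \<times> 'b \<Rightarrow>\<^sub>0 'k) \<Rightarrow> ('b \<times> 'b \<Rightarrow>\<^sub>0 'k)"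
  where "tensor_times m P Q =
    tensor_lift (\<odot>) (\<lambda>a b. tensor_lift (\<odot>) (\<lambda>c d. m a c \<otimes> m b d) Q) P"

lemma lookup_smult [simp]: "Poly_Mapping.lookup (c \<odot> p) b = c * Poly_Mapping.lookup p b"
  by (simp add: smult_def Poly_Mapping.map.rep_eq when_def)

lemma module_smult: "module ((\<odot>) :: 'k::comm_ring_1 \<Rightarrow> ('b \<Rightarrow>\<^sub>0 'k) \<Rightarrow> _)"
  by unfold_locales (auto intro!: poly_mapping_eqI simp: lookup_add algebra_simps)

lemma lookup_tensor [simp]:
  "Poly_Mapping.lookup (p \<otimes> q) (a, b) = Poly_Mapping.lookup p a * Poly_Mapping.lookup q b"
proof -
  have "Poly_Mapping.lookup (p \<otimes> q) (a, b) =
      (\<Sum>x\<in>Poly_Mapping.keys p. if x = a then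
        (\<Sum>y\<in>Poly_Mapping.keys q. if y = b then
           Poly_Mapping.lookup p x * Poly_Mapping.lookup q y else 0) else 0)"
    unfolding tensor_def lookup_sum lookup_single when_def
    by (intro sum.cong refl) (auto intro: sum.cong)
  also have "\<dots> = Poly_Mapping.lookup p a * Poly_Mapping.lookup q b"
    by (auto simp: in_keys_iff)
  finally show ?thesis .
qed

lemma tensor_in_free_mod:
  "p \<in> free_mod S \<Longrightarrow> q \<in> free_mod T \<Longrightarrow> p \<otimes> q \<in> free_mod (S \<times> T)"
  by (auto simp: free_mod_def in_keys_iff subset_iff) (metis mult_zero_left mult_zero_right)+

lemma lin_ext_superset:
  assumes "module s" "finite A" "Poly_Mapping.keys p \<subseteq> A"
  shows "lin_ext s f p = (\<Sum>b\<in>A. s (Poly_Mapping.lookup p b) (f b))"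
proof -
  interpret module s by fact
  show ?thesis unfolding lin_ext_def
    by (rule sum.mono_neutral_left) (use assms in \<open>auto simp: in_keys_iff\<close>)
qed

lemma lin_ext_linear:
  assumes "module s"
  shows "linear_map (\<odot>) s V UNIV (lin_ext s f)"
proof -
  interpret module s by fact
  have add: "lin_ext s f (x + y) = lin_ext s f x + lin_ext s f y" for x y
  proof -
    let ?A = "Poly_Mapping.keys x \<union> Poly_Mapping.keys y"
    have "Poly_Mapping.keys (x + y) \<subseteq> ?A"
      by (rule keys_add)
    then show ?thesis
      by (simp add: lin_ext_superset[OF assms, of ?A] lookup_add scale_left_distrib sum.distrib)
  qed
  have "lin_ext s f (c \<odot> x) = s c (lin_ext s f x)" for c x
  proof -
    have "Poly_Mapping.keys (c \<odot> x) \<subseteq> Poly_Mapping.keys x"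
      by (auto simp: in_keys_iff)
    then show ?thesis
      by (simp add: lin_ext_superset[OF assms, of "Poly_Mapping.keys x"] scale_sum_right)
  qed
  with add show ?thesis
    by (simp add: linear_map_def)
qed

lemma free_mod_expand: "p = (\<Sum>b\<in>Poly_Mapping.keys p. Poly_Mapping.lookup p b \<odot> basis b)"
  by (rule poly_mapping_eqI)
    (auto simp: lookup_sum lookup_single when_def if_distrib[of "\<lambda>x. _ * x"] in_keys_iff
      cong: if_cong)

lemma linear_map_eq_lin_ext:
  fixes s :: "'k::comm_ring_1 \<Rightarrow> 'm::ab_group_add \<Rightarrow> 'm" and f :: "('b \<Rightarrow>\<^sub>0 'k) \<Rightarrow> 'm"
  assumes "module s" and f: "linear_map (\<odot>) s (free_mod S) UNIV f" and p: "p \<in> free_mod S"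
  shows "f p = lin_ext s (\<lambda>b. f (basis b)) p"
proof -
  interpret module s by fact
  have zero: "f 0 = 0"
  proof -
    have "f ((0::'k) \<odot> 0) = s 0 (f 0)"
      using f by (auto simp: linear_map_def free_mod_def)
    moreover have "(0::'k) \<odot> (0 :: 'b \<Rightarrow>\<^sub>0 'k) = 0"
      by (rule poly_mapping_eqI) simp
    ultimately show ?thesis by simp
  qed
  have in_free: "Poly_Mapping.lookup p b \<odot> basis b \<in> free_mod S" if "b \<in> S" for b
    using that by (auto simp: free_mod_def in_keys_iff lookup_single when_def split: if_splits)
  have sums: "sum h A \<in> free_mod S \<and> f (sum h A) = (\<Sum>b\<in>A. f (h b))"
    if "finite A" "\<And>b. b \<in> A \<Longrightarrow> h b \<in> free_mod S" for A and h :: "'b \<Rightarrow> ('b \<Rightarrow>\<^sub>0 'k)"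
    using that
  proof (induction A)
    case empty
    then show ?case by (simp add: zero free_mod_def)
  next
    case (insert a A)
    then have "h a \<in> free_mod S" "sum h A \<in> free_mod S" by auto
    moreover from this have "h a + sum h A \<in> free_mod S"
      using keys_add[of "h a" "sum h A"] by (auto simp: free_mod_def)
    ultimately show ?case
      using insert f by (simp add: linear_map_def)
  qed
  have "f p = (\<Sum>b\<in>Poly_Mapping.keys p. f (Poly_Mapping.lookup p b \<odot> basis b))"
  proof (subst (1) free_mod_expand, rule conjunct2[OF sums])
    show "Poly_Mapping.lookup p b \<odot> basis b \<in> free_mod S" if "b \<in> Poly_Mapping.keys p" for b
      using that p by (intro in_free) (auto simp: free_mod_def)
  qed simp
  also have "\<dots> = lin_ext s (\<lambda>b. f (basis b)) p"
    unfolding lin_ext_def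
    by (intro sum.cong refl)
      (use f p in \<open>auto simp: linear_map_def free_mod_def subset_iff\<close>)
  finally show ?thesis .
qed

lemma tensor_lift_linear:
  "module s \<Longrightarrow> linear_map (\<odot>) s (free_mod (S \<times> T)) UNIV (tensor_lift s \<phi>)"
  unfolding tensor_lift_def by (rule lin_ext_linear)

lemma tensor_lift_tensor:
  assumes s: "module s"
    and l: "\<And>y. y \<in> free_mod T \<Longrightarrow> linear_map (\<odot>) s (free_mod S) UNIV (\<lambda>x. \<phi> x y)"
    and r: "\<And>x. x \<in> free_mod S \<Longrightarrow> linear_map (\<odot>) s (free_mod T) UNIV (\<phi> x)"
    and x: "x \<in> free_mod S" and y: "y \<in> free_mod T"
  shows "tensor_lift s \<phi> (x \<otimes> y) = \<phi> x y"
proof -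
  interpret module s by fact
  have "\<phi> x y = lin_ext s (\<lambda>a. \<phi> (basis a) y) x"
    by (rule linear_map_eq_lin_ext[OF s l[OF y] x])
  also have "\<dots> = lin_ext s (\<lambda>a. lin_ext s (\<lambda>b. \<phi> (basis a) (basis b)) y) x"
    unfolding lin_ext_def[of s _ x]
  proof (intro sum.cong refl)
    fix a assume "a \<in> Poly_Mapping.keys x"
    then have "basis a \<in> free_mod S"
      using x by (auto simp: free_mod_def)
    from linear_map_eq_lin_ext[OF s r[OF this] y]
    show "s (Poly_Mapping.lookup x a) (\<phi> (basis a) y) =
      s (Poly_Mapping.lookup x a) (lin_ext s (\<lambda>b. \<phi> (basis a) (basis b)) y)" by simp
  qed
  also have "\<dots> = (\<Sum>c\<in>Poly_Mapping.keys x \<times> Poly_Mapping.keys y.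
      s (Poly_Mapping.lookup (x \<otimes> y) c) (case c of (a, b) \<Rightarrow> \<phi> (basis a) (basis b)))"
    by (simp add: lin_ext_def scale_sum_right sum.cartesian_product split_def
        flip: lookup_tensor)
  also have "\<dots> = tensor_lift s \<phi> (x \<otimes> y)"
    unfolding tensor_lift_def
    by (rule lin_ext_superset[OF s, symmetric]) (auto simp: in_keys_iff)
  finally show ?thesis by simp
qed

lemma tensor_lift_unique:
  assumes s: "module s" and g: "linear_map (\<odot>) s (free_mod (S \<times> T)) UNIV g"
    and eq: "\<And>x y. x \<in> free_mod S \<Longrightarrow> y \<in> free_mod T \<Longrightarrow> g (x \<otimes> y) = \<phi> x y"
    and P: "P \<in> free_mod (S \<times> T)"
  shows "g P = tensor_lift s \<phi> P"
proof -
  have bt: "basis (a, b) = basis a \<otimes> basis b" for a b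
    by (rule poly_mapping_eqI) (auto simp: lookup_single when_def split_paired_all)
  have "g P = lin_ext s (\<lambda>c. g (basis c)) P"
    by (rule linear_map_eq_lin_ext[where f = g, OF s g P])
  also have "\<dots> = tensor_lift s \<phi> P"
    unfolding tensor_lift_def lin_ext_def
  proof (intro sum.cong refl)
    fix c assume c: "c \<in> Poly_Mapping.keys P"
    obtain a b where [simp]: "c = (a, b)" by (cases c)
    have "a \<in> S" "b \<in> T"
      using P c by (auto simp: free_mod_def)
    then have "g (basis c) = \<phi> (basis a) (basis b)"
      using eq[of "basis a" "basis b"] by (simp add: bt free_mod_def)
    then show "s (Poly_Mapping.lookup P c) (g (basis c)) =
        s (Poly_Mapping.lookup P c) (case c of (a, b) \<Rightarrow> \<phi> (basis a) (basis b))"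
      by simp
  qed
  finally show ?thesis .
qed


section \<open>Coalgebras, filtrations and Hopf algebras\<close>

text \<open>
  All structures live on the free module on \<open>S\<close>. In the counit laws \<open>\<^bold>k \<otimes> C\<close> and \<open>C \<otimes> \<^bold>k\<close>
  are identified with \<open>C\<close>.
\<close>

locale coalgebra =
  fixes S :: "'b set"
    and \<Delta> :: "('b \<Rightarrow>\<^sub>0 'k::comm_ring_1) \<Rightarrow> ('b \<times> 'b \<Rightarrow>\<^sub>0 'k)"
    and \<epsilon> :: "('b \<Rightarrow>\<^sub>0 'k) \<Rightarrow> 'k"
  assumes comult_linear: "linear_map (\<odot>) (\<odot>) (free_mod S) (free_mod (S \<times> S)) \<Delta>"
    and counit_linear: "linear_map (\<odot>) (*) (free_mod S) UNIV \<epsilon>"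
    and coassoc: "x \<in> free_mod S \<Longrightarrow>
      tensor_assoc (tensor_map \<Delta> (\<lambda>y. y) (\<Delta> x)) = tensor_map (\<lambda>y. y) \<Delta> (\<Delta> x)"
    and counit_left: "x \<in> free_mod S \<Longrightarrow> tensor_lift (\<odot>) (\<lambda>y z. \<epsilon> y \<odot> z) (\<Delta> x) = x"
    and counit_right: "x \<in> free_mod S \<Longrightarrow> tensor_lift (\<odot>) (\<lambda>y z. \<epsilon> z \<odot> y) (\<Delta> x) = x"

locale coaugmented_coalgebra = coalgebra S \<Delta> \<epsilon>
  for S :: "'b set" and \<Delta> and \<epsilon> :: "('b \<Rightarrow>\<^sub>0 'k::comm_ring_1) \<Rightarrow> 'k" +
  fixes u :: "'k \<Rightarrow> ('b \<Rightarrow>\<^sub>0 'k)"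
  assumes coaug_linear: "linear_map (*) (\<odot>) UNIV (free_mod S) u"
    and counit_coaug: "\<epsilon> (u c) = c"

text \<open>
  \<open>C\<^bsub>(p)\<^esub> \<otimes> C\<^bsub>(q)\<^esub>\<close> is read inside \<open>C \<otimes> C\<close>, i.e. as the span of the pure tensors.
\<close>

locale cofiltered_coaugmented_coalgebra = coaugmented_coalgebra S \<Delta> \<epsilon> u
  for S :: "'b set" and \<Delta> and \<epsilon> :: "('b \<Rightarrow>\<^sub>0 'k::comm_ring_1) \<Rightarrow> 'k" and u +
  fixes F :: "nat \<Rightarrow> ('b \<Rightarrow>\<^sub>0 'k) set"
  assumes filt_submodule: "module.subspace (\<odot>) (F n)"
    and filt_mono: "F n \<subseteq> F (Suc n)"
    and filt_exhaustive: "(\<Union>n. F n) = free_mod S"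
    and coaug_filt: "range u \<subseteq> F n"
    and comult_filt: "\<Delta> ` F n \<subseteq>
      module.span (\<odot>) (\<Union>(p, q) \<in> {(p, q). p + q = n}. {x \<otimes> y | x y. x \<in> F p \<and> y \<in> F q})"

locale connected_cofiltered_coaugmented_coalgebra =
  cofiltered_coaugmented_coalgebra S \<Delta> \<epsilon> u F
  for S :: "'b set" and \<Delta> and \<epsilon> :: "('b \<Rightarrow>\<^sub>0 'k::comm_ring_1) \<Rightarrow> 'k" and u and F +
  assumes connected: "F 0 = range u"

locale unital_algebra =
  fixes S :: "'b set"
    and m :: "('b \<Rightarrow>\<^sub>0 'k::comm_ring_1) \<Rightarrow> ('b \<Rightarrow>\<^sub>0 'k) \<Rightarrow> ('b \<Rightarrow>\<^sub>0 'k)"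
    and e :: "'b \<Rightarrow>\<^sub>0 'k"
  assumes mult_linear_left:
      "y \<in> free_mod S \<Longrightarrow> linear_map (\<odot>) (\<odot>) (free_mod S) (free_mod S) (\<lambda>x. m x y)"
    and mult_linear_right:
      "x \<in> free_mod S \<Longrightarrow> linear_map (\<odot>) (\<odot>) (free_mod S) (free_mod S) (m x)"
    and mult_assoc: "x \<in> free_mod S \<Longrightarrow> y \<in> free_mod S \<Longrightarrow> z \<in> free_mod S \<Longrightarrow>
      m (m x y) z = m x (m y z)"
    and unit_closed: "e \<in> free_mod S"
    and unit_left: "x \<in> free_mod S \<Longrightarrow> m e x = x"
    and unit_right: "x \<in> free_mod S \<Longrightarrow> m x e = x"

locale bialgebra = unital_algebra S m e + coalgebra S \<Delta> \<epsilon>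
  for S :: "'b set" and m :: "('b \<Rightarrow>\<^sub>0 'k::comm_ring_1) \<Rightarrow> _" and e and \<Delta> and \<epsilon> +
  assumes comult_mult: "x \<in> free_mod S \<Longrightarrow> y \<in> free_mod S \<Longrightarrow>
      \<Delta> (m x y) = tensor_times m (\<Delta> x) (\<Delta> y)"
    and comult_unit: "\<Delta> e = e \<otimes> e"
    and counit_mult: "x \<in> free_mod S \<Longrightarrow> y \<in> free_mod S \<Longrightarrow> \<epsilon> (m x y) = \<epsilon> x * \<epsilon> y"
    and counit_unit: "\<epsilon> e = 1"

locale hopf_algebra = bialgebra S m e \<Delta> \<epsilon>
  for S :: "'b set" and m :: "('b \<Rightarrow>\<^sub>0 'k::comm_ring_1) \<Rightarrow> _" and e and \<Delta> and \<epsilon> +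
  assumes antipode: "\<exists>A. linear_map (\<odot>) (\<odot>) (free_mod S) (free_mod S) A \<and>
    (\<forall>x\<in>free_mod S.
      tensor_lift (\<odot>) (\<lambda>y z. m (A y) z) (\<Delta> x) = \<epsilon> x \<odot> e \<and>
      tensor_lift (\<odot>) (\<lambda>y z. m y (A z)) (\<Delta> x) = \<epsilon> x \<odot> e)"


section \<open>Decorated planar rooted forests\<close>

datatype 'a ptree = Node 'a "'a ptree list"

fun decorated :: "'a set \<Rightarrow> 'a set \<Rightarrow> 'a ptree \<Rightarrow> bool"
  where "decorated X \<Omega> (Node a F) \<longleftrightarrow>
    (if F = [] then a \<in> X \<union> \<Omega> else a \<in> \<Omega> \<and> (\<forall>T\<in>set F. decorated X \<Omega> T))"

definition trees_RT :: "'a set \<Rightarrow> 'a set \<Rightarrow> 'a ptree set"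
  where "trees_RT X \<Omega> = {T. decorated X \<Omega> T}"

definition forests_RT :: "'a set \<Rightarrow> 'a set \<Rightarrow> 'a ptree list set"
  where "forests_RT X \<Omega> = lists (trees_RT X \<Omega>)"

fun vertices :: "'a ptree \<Rightarrow> nat"
  where "vertices (Node a F) = Suc (\<Sum>T\<leftarrow>F. vertices T)"

text \<open>
  With lists as a monoid, written additively, under concatenation, \<open>'a ptree list \<Rightarrow>\<^sub>0 'k\<close> carries
  the ring structure of the monoid algebra: its product \<open>*\<close> is the concatenation product and
  its \<open>1\<close> is the empty forest. Likewise the product \<open>*\<close> on
  \<open>'a ptree list \<times> 'a ptree list \<Rightarrow>\<^sub>0 'k\<close> is the one of the tensor product algebra,
  see \<open>tensor_mult\<close> and \<open>tensor_times_eq\<close>.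
\<close>

instantiation list :: (type) monoid_add
begin
definition zero_list_def: "0 = []"
definition plus_list_def: "xs + ys = xs @ ys"
instance by standard (simp_all add: zero_list_def plus_list_def)
end

definition graft :: "'a \<Rightarrow> ('a ptree list \<Rightarrow>\<^sub>0 'k::comm_ring_1) \<Rightarrow> ('a ptree list \<Rightarrow>\<^sub>0 'k)"
  where "graft \<omega> = lin_ext (\<odot>) (\<lambda>F. basis [Node \<omega> F])"

text \<open>
  If \<open>X\<close> and \<open>\<Omega>\<close> are disjoint, a decorated tree \<open>Node a F\<close> with \<open>a \<in> X\<close> has \<open>F = []\<close>, and any
  other one is the grafting of \<open>F\<close> onto a root decorated by \<open>a \<in> \<Omega>\<close>.
\<close>

fun comult_tree :: "'a set \<Rightarrow> ('a \<Rightarrow> 'k::comm_ring_1) \<Rightarrow> ('a \<Rightarrow> 'k) \<Rightarrow> 'a ptree \<Rightarrow>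
      ('a ptree list \<times> 'a ptree list \<Rightarrow>\<^sub>0 'k)"
  and comult_forest :: "'a set \<Rightarrow> ('a \<Rightarrow> 'k::comm_ring_1) \<Rightarrow> ('a \<Rightarrow> 'k) \<Rightarrow> 'a ptree list \<Rightarrow>
      ('a ptree list \<times> 'a ptree list \<Rightarrow>\<^sub>0 'k)"
  where
    "comult_tree X \<mu> lam (Node a F) =
      (if a \<in> X
       then basis [Node a F] \<otimes> 1 + 1 \<otimes> basis [Node a F] + \<mu> a \<odot> (1 \<otimes> 1)
       else basis [Node a F] \<otimes> 1
         + tensor_map (\<lambda>x. x) (graft a) (comult_forest X \<mu> lam F)
         + lam a \<odot> (basis F \<otimes> 1))"
  | "comult_forest X \<mu> lam [] = 1 \<otimes> 1"
  | "comult_forest X \<mu> lam (T # F) = comult_tree X \<mu> lam T * comult_forest X \<mu> lam F"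

definition comult_RT :: "'a set \<Rightarrow> ('a \<Rightarrow> 'k::comm_ring_1) \<Rightarrow> ('a \<Rightarrow> 'k) \<Rightarrow>
    ('a ptree list \<Rightarrow>\<^sub>0 'k) \<Rightarrow> ('a ptree list \<times> 'a ptree list \<Rightarrow>\<^sub>0 'k)"
  where "comult_RT X \<mu> lam = lin_ext (\<odot>) (comult_forest X \<mu> lam)"

fun counit_tree :: "'a set \<Rightarrow> ('a \<Rightarrow> 'k::comm_ring_1) \<Rightarrow> ('a \<Rightarrow> 'k) \<Rightarrow> 'a ptree \<Rightarrow> 'k"
  and counit_forest :: "'a set \<Rightarrow> ('a \<Rightarrow> 'k::comm_ring_1) \<Rightarrow> ('a \<Rightarrow> 'k) \<Rightarrow> 'a ptree list \<Rightarrow> 'k"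
  where
    "counit_tree X \<mu> lam (Node a F) =
      (if a \<in> X then - \<mu> a else - lam a * counit_forest X \<mu> lam F)"
  | "counit_forest X \<mu> lam [] = 1"
  | "counit_forest X \<mu> lam (T # F) = counit_tree X \<mu> lam T * counit_forest X \<mu> lam F"

definition counit_RT :: "'a set \<Rightarrow> ('a \<Rightarrow> 'k::comm_ring_1) \<Rightarrow> ('a \<Rightarrow> 'k) \<Rightarrow>
    ('a ptree list \<Rightarrow>\<^sub>0 'k) \<Rightarrow> 'k"
  where "counit_RT X \<mu> lam = lin_ext (*) (counit_forest X \<mu> lam)"

definition graded_RT :: "'a set \<Rightarrow> 'a set \<Rightarrow> nat \<Rightarrow> ('a ptree list \<Rightarrow>\<^sub>0 'k::comm_ring_1) set"
  where "graded_RT X \<Omega> k =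
    module.span (\<odot>) (basis ` {F \<in> forests_RT X \<Omega>. (\<Sum>T\<leftarrow>F. vertices T) = k})"

definition filt_RT :: "'a set \<Rightarrow> 'a set \<Rightarrow> nat \<Rightarrow> ('a ptree list \<Rightarrow>\<^sub>0 'k::comm_ring_1) set"
  where "filt_RT X \<Omega> n = {\<Sum>k\<le>n. h k | h. \<forall>k\<le>n. h k \<in> graded_RT X \<Omega> k}"

lemma one_eq_basis: "(1 :: 'a ptree list \<Rightarrow>\<^sub>0 'k::comm_ring_1) = basis []"
  by (simp add: zero_list_def flip: single_one)

lemma basis_mult:
  "basis F * basis G = (basis (F @ G) :: 'a ptree list \<Rightarrow>\<^sub>0 'k::comm_ring_1)"
  by (simp add: mult_single plus_list_def)

lemma graft_basis: "graft \<omega> (basis F) = basis [Node \<omega> F]"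
  by (auto simp: graft_def lin_ext_def intro: poly_mapping_eqI)

lemma tensor_single:
  "Poly_Mapping.single a c \<otimes> Poly_Mapping.single b d = Poly_Mapping.single (a, b) (c * d)"
  by (rule poly_mapping_eqI) (auto simp: lookup_single when_def split_paired_all)

lemma tensor_sum_left: "(\<Sum>i\<in>A. f i) \<otimes> q = (\<Sum>i\<in>A. f i \<otimes> q)"
  by (rule poly_mapping_eqI) (auto simp: lookup_sum sum_distrib_right split_paired_all)

lemma tensor_sum_right: "p \<otimes> (\<Sum>i\<in>A. f i) = (\<Sum>i\<in>A. p \<otimes> f i)"
  by (rule poly_mapping_eqI) (auto simp: lookup_sum sum_distrib_left split_paired_all)

lemma smult_single: "c \<odot> Poly_Mapping.single b d = Poly_Mapping.single b (c * d)"
  by (rule poly_mapping_eqI) (auto simp: lookup_single when_def)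

lemma expand_single:
  "(p :: 'b \<Rightarrow>\<^sub>0 'k::comm_ring_1) = (\<Sum>b\<in>Poly_Mapping.keys p. Poly_Mapping.single b (Poly_Mapping.lookup p b))"
  using free_mod_expand[of p] by (simp add: smult_single)

lemma tensor_mult:
  fixes a b c d :: "'b::monoid_add \<Rightarrow>\<^sub>0 'k::comm_ring_1"
  shows "(a \<otimes> b) * (c \<otimes> d) = (a * c) \<otimes> (b * d)"
proof -
  have 1: "(Poly_Mapping.single x r \<otimes> Poly_Mapping.single y s) *
      (Poly_Mapping.single z t \<otimes> Poly_Mapping.single w v) =
      (Poly_Mapping.single x r * Poly_Mapping.single z t) \<otimes>
      (Poly_Mapping.single y s * Poly_Mapping.single w v)" for x y z w :: 'b and r s t v :: 'k
    by (simp add: tensor_single mult_single plus_prod_def mult_ac)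
  have 2: "(Poly_Mapping.single x r \<otimes> Poly_Mapping.single y s) *
      (Poly_Mapping.single z t \<otimes> d) =
      (Poly_Mapping.single x r * Poly_Mapping.single z t) \<otimes>
      (Poly_Mapping.single y s * d)" for x y z :: 'b and r s t :: 'k
    by (subst (1 2) expand_single[of d])
      (simp only: tensor_sum_right sum_distrib_left 1)
  have 3: "(Poly_Mapping.single x r \<otimes> Poly_Mapping.single y s) * (c \<otimes> d) =
      (Poly_Mapping.single x r * c) \<otimes> (Poly_Mapping.single y s * d)" for x y :: 'b and r s :: 'k
    by (subst (1 2) expand_single[of c])
      (simp only: tensor_sum_left sum_distrib_left 2)
  have 4: "(Poly_Mapping.single x r \<otimes> b) * (c \<otimes> d) =
      (Poly_Mapping.single x r * c) \<otimes> (b * d)" for x :: 'b and r :: 'k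
    by (subst (1 2) expand_single[of b])
      (simp only: tensor_sum_right sum_distrib_right 3)
  show ?thesis
    by (subst (1 2) expand_single[of a])
      (simp only: tensor_sum_left sum_distrib_right 4)
qed

lemma tensor_times_eq:
  fixes P Q :: "'b::monoid_add \<times> 'b \<Rightarrow>\<^sub>0 'k::comm_ring_1"
  shows "tensor_times (*) P Q = P * Q"
proof -
  interpret module "(\<odot>) :: 'k \<Rightarrow> ('b \<times> 'b \<Rightarrow>\<^sub>0 'k) \<Rightarrow> _"
    by (rule module_smult)
  have "P * Q = (\<Sum>x\<in>Poly_Mapping.keys P. \<Sum>y\<in>Poly_Mapping.keys Q.
      Poly_Mapping.single x (Poly_Mapping.lookup P x) *
      Poly_Mapping.single y (Poly_Mapping.lookup Q y))"
    by (subst expand_single[of P], subst expand_single[of Q]) (rule sum_product)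
  also have "\<dots> = tensor_times (*) P Q"
    by (simp add: tensor_times_def tensor_lift_def lin_ext_def split_def tensor_single
        mult_single smult_single scale_sum_right plus_prod_def)
  finally show ?thesis by simp
qed

end

theory Submission
  imports Defs
begin

text \<open>
  The coproduct and the counit are multiplicative, so coassociativity and the counit laws are only
  needed on single trees, where they follow by structural induction from the
  formula for \<open>\<Delta> \<circ> graft a\<close>. A connected cofiltered bialgebra has an antipode because the identity
  is \<open>e \<circ> \<epsilon> - d\<close> in the convolution algebra, where \<open>d = e \<circ> \<epsilon> - id\<close> vanishes on filtration degree
  \<open>0\<close>; hence \<open>d\<^sup>k\<close> vanishes on degree \<open>< k\<close> and the geometric series of \<open>d\<close> is a finite sum on each
  element.
\<close>

section \<open>Linear extension\<close>

text \<open>The terms with \<open>\<mu>\<close> and \<open>lam\<close> lose a vertex, so in general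
  \<Delta> respects the number of vertices only up to smaller values; this is why a filtration takes
  the place of a grading. For the same reason the counit need not vanish on nonempty forests, and
  its minus signs are what cancels these terms in the counit laws. The inversion of the identity
  uses only that \<open>d\<close> vanishes in degree \<open>0\<close>, never an expansion of
  \<Delta>(x) as x \<otimes> 1 + 1 \<otimes> x plus smaller terms. Identities are tested on basis
  elements. \<open>lin_ext\<close> is linear on the whole type, so composites of concrete maps can
  be rewritten freely. An abstract product or coproduct is linear on \<open>free_mod S\<close> only,
  whence the closure conditions that accompany every statement on convolution.\<close>

lemma module_hom_lin_ext:
  "module s \<Longrightarrow> module_hom (\<odot>) s (lin_ext s f)"
  using lin_ext_linear[of s UNIV f]
  by (simp add: module_hom_iff linear_map_def module_smult)

lemma module_mult: "module ((*) :: 'k::comm_ring_1 \<Rightarrow> 'k \<Rightarrow> 'k)"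
  by unfold_locales (simp_all add: algebra_simps)

lemma lin_ext_single: "module s \<Longrightarrow> lin_ext s f (Poly_Mapping.single b c) = s c (f b)"
  using lin_ext_superset[of s "{b}" "Poly_Mapping.single b c" f] by simp

lemma lin_ext_basis: "module s \<Longrightarrow> lin_ext s f (basis b) = f b"
  by (simp add: lin_ext_single module.scale_one)

lemma lin_ext_cong:
  "(\<And>b. b \<in> Poly_Mapping.keys p \<Longrightarrow> f b = g b) \<Longrightarrow> lin_ext s f p = lin_ext s g p"
  by (simp add: lin_ext_def)

lemma lin_ext_fun_add:
  "module s \<Longrightarrow> lin_ext s (\<lambda>b. f b + g b) p = lin_ext s f p + lin_ext s g p"
  by (simp add: lin_ext_def module.scale_right_distrib sum.distrib)

lemma lin_ext_fun_diff:
  "module s \<Longrightarrow> lin_ext s (\<lambda>b. f b - g b) p = lin_ext s f p - lin_ext s g p"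
  by (simp add: lin_ext_def module.scale_right_diff_distrib sum_subtractf)

lemma lin_ext_fun_scale:
  fixes s :: "'k::comm_ring_1 \<Rightarrow> 'm::ab_group_add \<Rightarrow> 'm"
  assumes "module s"
  shows "lin_ext s (\<lambda>b. s c (f b)) p = s c (lin_ext s f p)"
proof -
  interpret module s by fact
  show ?thesis by (simp add: lin_ext_def scale_sum_right mult.commute)
qed

lemma module_hom_lin_ext_comp:
  assumes "module_hom s t h"
  shows "h (lin_ext s f p) = lin_ext t (\<lambda>b. h (f b)) p"
proof -
  interpret module_hom s t h by fact
  show ?thesis by (simp add: lin_ext_def sum scale)
qed

text \<open>Together with \<open>lin_ext_tensor\<close> this rewrites composites of maps on tensors
  to nested extensions, a normal form in which two maps are compared through their values on the
  basis.\<close>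

lemma lin_ext_lin_ext:
  "module s \<Longrightarrow> lin_ext s f (lin_ext (\<odot>) g p) = lin_ext s (\<lambda>b. lin_ext s f (g b)) p"
  by (simp add: module_hom_lin_ext_comp module_hom_lin_ext)

lemma lin_ext_basis_id: "lin_ext (\<odot>) basis p = p"
  by (simp add: lin_ext_def flip: free_mod_expand)

lemma linear_map_add: "linear_map s t V W f \<Longrightarrow> x \<in> V \<Longrightarrow> y \<in> V \<Longrightarrow> f (x + y) = f x + f y"
  and linear_map_scale: "linear_map s t V W f \<Longrightarrow> x \<in> V \<Longrightarrow> f (s c x) = t c (f x)"
  and linear_map_closed: "linear_map s t V W f \<Longrightarrow> x \<in> V \<Longrightarrow> f x \<in> W"
  unfolding linear_map_def by blast+

lemma linear_map_mono:
  "linear_map s t V W f \<Longrightarrow> W \<subseteq> W' \<Longrightarrow> linear_map s t V W' f"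
  by (auto simp: linear_map_def)

section \<open>Free submodules and maps that are linear on them only\<close>

lemma subspace_free_mod: "module.subspace (\<odot>) (free_mod S :: ('b \<Rightarrow>\<^sub>0 'k::comm_ring_1) set)"
proof -
  interpret module "(\<odot>) :: 'k \<Rightarrow> ('b \<Rightarrow>\<^sub>0 'k) \<Rightarrow> _" by (rule module_smult)
  show ?thesis
  proof (rule subspaceI)
    fix p q :: "'b \<Rightarrow>\<^sub>0 'k" assume "p \<in> free_mod S" "q \<in> free_mod S"
    then show "p + q \<in> free_mod S"
      using keys_add[of p q] by (auto simp: free_mod_def)
  next
    fix c and p :: "'b \<Rightarrow>\<^sub>0 'k" assume "p \<in> free_mod S"
    moreover have "Poly_Mapping.keys (c \<odot> p) \<subseteq> Poly_Mapping.keys p"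
      by (auto simp: in_keys_iff)
    ultimately show "c \<odot> p \<in> free_mod S"
      by (auto simp: free_mod_def)
  qed (simp add: free_mod_def)
qed

lemma free_mod_add: "p \<in> free_mod S \<Longrightarrow> q \<in> free_mod S \<Longrightarrow> p + q \<in> free_mod S"
  and free_mod_diff: "p \<in> free_mod S \<Longrightarrow> q \<in> free_mod S \<Longrightarrow> p - q \<in> free_mod S"
  and free_mod_smult: "p \<in> free_mod S \<Longrightarrow> c \<odot> p \<in> free_mod S"
  and free_mod_sum: "(\<And>i. i \<in> I \<Longrightarrow> f i \<in> free_mod S) \<Longrightarrow> sum f I \<in> free_mod S"
  for p q :: "'b \<Rightarrow>\<^sub>0 'k::comm_ring_1"
  using module.subspace_add[OF module_smult subspace_free_mod]
    module.subspace_diff[OF module_smult subspace_free_mod]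
    module.subspace_scale[OF module_smult subspace_free_mod]
    module.subspace_sum[OF module_smult subspace_free_mod] by blast+

lemma free_mod_mono: "S \<subseteq> T \<Longrightarrow> free_mod S \<subseteq> free_mod T"
  by (auto simp: free_mod_def)

lemma basis_in_free_mod: "b \<in> S \<Longrightarrow> basis b \<in> free_mod S"
  by (simp add: free_mod_def)

lemma lin_ext_closed:
  "p \<in> free_mod S \<Longrightarrow> (\<And>b. b \<in> S \<Longrightarrow> f b \<in> free_mod T) \<Longrightarrow> lin_ext (\<odot>) f p \<in> free_mod T"
  unfolding lin_ext_def by (intro free_mod_sum free_mod_smult) (auto simp: free_mod_def)

lemma span_basis: "module.span (\<odot>) (basis ` B) = (free_mod B :: ('b \<Rightarrow>\<^sub>0 'k::comm_ring_1) set)"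
proof -
  interpret module "(\<odot>) :: 'k \<Rightarrow> ('b \<Rightarrow>\<^sub>0 'k) \<Rightarrow> _" by (rule module_smult)
  show ?thesis
  proof (rule span_unique)
    fix V :: "('b \<Rightarrow>\<^sub>0 'k) set"
    assume V: "basis ` B \<subseteq> V" "subspace V"
    show "free_mod B \<subseteq> V"
    proof
      fix p :: "'b \<Rightarrow>\<^sub>0 'k" assume "p \<in> free_mod B"
      with V show "p \<in> V"
        by (subst free_mod_expand)
          (auto intro!: subspace_sum subspace_scale simp: free_mod_def)
    qed
  qed (auto simp: basis_in_free_mod subspace_free_mod)
qed

lemma linear_map_lin_ext:
  assumes "linear_map (\<odot>) s (free_mod S) W h" "module s" "p \<in> free_mod S"
  shows "h p = lin_ext s (\<lambda>b. h (basis b)) p"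
  using assms linear_map_eq_lin_ext[of s S h p] by (auto intro: linear_map_mono)

text \<open>Counterpart of \<open>module_hom_lin_ext_comp\<close> for maps known to be linear only
  on a free submodule, such as the abstract product of an algebra; hence the values of
  \<open>f\<close> have to stay in that submodule.\<close>

lemma linear_map_lin_ext_comp:
  assumes h: "linear_map (\<odot>) s (free_mod T) W h" and s: "module s"
    and p: "p \<in> free_mod S" and f: "\<And>b. b \<in> S \<Longrightarrow> f b \<in> free_mod T"
  shows "h (lin_ext (\<odot>) f p) = lin_ext s (\<lambda>b. h (f b)) p"
proof -
  have "h (lin_ext (\<odot>) f p) = lin_ext s (\<lambda>b. lin_ext s (\<lambda>b. h (basis b)) (f b)) p"
    using linear_map_lin_ext[OF h s lin_ext_closed[OF p f]] by (simp add: s lin_ext_lin_ext)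
  also have "\<dots> = lin_ext s (\<lambda>b. h (f b)) p"
    by (rule lin_ext_cong) (use p f in \<open>auto simp: free_mod_def linear_map_lin_ext[OF h s, symmetric]\<close>)
  finally show ?thesis .
qed

lemma linear_map_lin_ext_into:
  "(\<And>b. b \<in> S \<Longrightarrow> f b \<in> free_mod T) \<Longrightarrow>
    linear_map (\<odot>) (\<odot>) (free_mod S) (free_mod T) (lin_ext (\<odot>) f)"
  using lin_ext_linear[OF module_smult, of "free_mod S" f]
  by (auto simp: linear_map_def lin_ext_closed)

section \<open>Bilinearity of pure tensors\<close>

lemma tensor_add_left: "(p + p') \<otimes> q = p \<otimes> q + p' \<otimes> q"
  and tensor_add_right: "p \<otimes> (q + q') = p \<otimes> q + p \<otimes> q'"
  and tensor_smult_left: "(c \<odot> p) \<otimes> q = c \<odot> (p \<otimes> q)"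
  and tensor_smult_right: "p \<otimes> (c \<odot> q) = c \<odot> (p \<otimes> q)"
  by (rule poly_mapping_eqI; auto simp: lookup_add algebra_simps)+

lemma module_hom_tensor_left: "module_hom (\<odot>) (\<odot>) (\<lambda>p. p \<otimes> q)"
  and module_hom_tensor_right: "module_hom (\<odot>) (\<odot>) (\<lambda>q. p \<otimes> q)"
  by (simp_all add: module_hom_iff module_smult tensor_add_left tensor_add_right
      tensor_smult_left tensor_smult_right)

lemmas lin_ext_tensor_left = module_hom_lin_ext_comp[OF module_hom_tensor_left]
  and lin_ext_tensor_right = module_hom_lin_ext_comp[OF module_hom_tensor_right]

lemma basis_tensor: "basis a \<otimes> basis b = basis (a, b)"
  by (simp add: tensor_single)

lemma lin_ext_tensor:
  fixes p :: "'b \<Rightarrow>\<^sub>0 'k::comm_ring_1" and q :: "'c \<Rightarrow>\<^sub>0 'k"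
  assumes "module s"
  shows "lin_ext s f (p \<otimes> q) = lin_ext s (\<lambda>a. lin_ext s (\<lambda>b. f (a, b)) q) p"
proof -
  have "basis a \<otimes> q = lin_ext (\<odot>) (\<lambda>b. basis (a, b)) q" for a :: 'b
    using lin_ext_tensor_right[of "basis a" basis q] by (simp only: lin_ext_basis_id basis_tensor)
  then have "p \<otimes> q = lin_ext (\<odot>) (\<lambda>a. lin_ext (\<odot>) (\<lambda>b. basis (a, b)) q) p"
    using lin_ext_tensor_left[of basis p q] by (simp only: lin_ext_basis_id)
  then show ?thesis
    by (simp only: lin_ext_lin_ext[OF assms] lin_ext_basis[OF assms])
qed

lemma tensor_map_eq: "tensor_map f g = lin_ext (\<odot>) (\<lambda>(a, b). f (basis a) \<otimes> g (basis b))"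
  by (simp add: tensor_map_def tensor_lift_def)

section \<open>Connected cofiltered bialgebras are Hopf algebras\<close>

context bialgebra
begin

text \<open>Linear maps are represented by their values on the basis, hence the type of \<open>conv\<close>.\<close>

definition conv :: "('b \<Rightarrow> ('b \<Rightarrow>\<^sub>0 'k)) \<Rightarrow> ('b \<Rightarrow> ('b \<Rightarrow>\<^sub>0 'k)) \<Rightarrow> 'b \<Rightarrow> ('b \<Rightarrow>\<^sub>0 'k)"
  where "conv f g x = lin_ext (\<odot>) (\<lambda>(a, b). m (f a) (g b)) (\<Delta> (basis x))"

definition conv_unit :: "'b \<Rightarrow> ('b \<Rightarrow>\<^sub>0 'k)"
  where "conv_unit x = \<epsilon> (basis x) \<odot> e"

definition defect :: "'b \<Rightarrow> ('b \<Rightarrow>\<^sub>0 'k)"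
  where "defect x = conv_unit x - basis x"

fun defect_pow :: "nat \<Rightarrow> 'b \<Rightarrow> ('b \<Rightarrow>\<^sub>0 'k)"
  where "defect_pow 0 = conv_unit"
  | "defect_pow (Suc k) = conv defect (defect_pow k)"

section \<open>Convolution as an associative product with unit\<close>

lemma mult_closed: "x \<in> free_mod S \<Longrightarrow> y \<in> free_mod S \<Longrightarrow> m x y \<in> free_mod S"
  using linear_map_closed[OF mult_linear_right] .

lemma comult_closed: "x \<in> free_mod S \<Longrightarrow> \<Delta> x \<in> free_mod (S \<times> S)"
  using linear_map_closed[OF comult_linear] .

lemma mult_diff_left:
  assumes "x \<in> free_mod S" "y \<in> free_mod S" "z \<in> free_mod S"
  shows "m (x - y) z = m x z - m y z"
  using linear_map_add[OF mult_linear_left[of z], of "x - y" y] assms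
  by (simp add: free_mod_diff)

lemma mult_diff_right:
  assumes "x \<in> free_mod S" "y \<in> free_mod S" "z \<in> free_mod S"
  shows "m z (x - y) = m z x - m z y"
  using linear_map_add[OF mult_linear_right[of z], of "x - y" y] assms
  by (simp add: free_mod_diff)

lemma conv_unit_closed: "conv_unit x \<in> free_mod S"
  by (simp add: conv_unit_def free_mod_smult unit_closed)

lemma conv_closed:
  assumes "\<And>x. x \<in> S \<Longrightarrow> f x \<in> free_mod S" "\<And>x. x \<in> S \<Longrightarrow> g x \<in> free_mod S" "x \<in> S"
  shows "conv f g x \<in> free_mod S"
  unfolding conv_def
  by (rule lin_ext_closed[OF comult_closed[OF basis_in_free_mod]])
    (use assms in \<open>auto intro: mult_closed\<close>)

lemma defect_closed: "x \<in> S \<Longrightarrow> defect x \<in> free_mod S"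
  by (simp add: defect_def conv_unit_closed free_mod_diff basis_in_free_mod)

lemma defect_pow_closed: "x \<in> S \<Longrightarrow> defect_pow k x \<in> free_mod S"
  by (induction k arbitrary: x) (auto simp: conv_unit_closed intro: conv_closed defect_closed)

lemma conv_cong:
  assumes "x \<in> S" "\<And>y. y \<in> S \<Longrightarrow> f y = f' y" "\<And>y. y \<in> S \<Longrightarrow> g y = g' y"
  shows "conv f g x = conv f' g' x"
  unfolding conv_def
  by (rule lin_ext_cong)
    (use comult_closed[OF basis_in_free_mod[OF assms(1)]] assms in \<open>auto simp: free_mod_def\<close>)

text \<open>Once the scalar is pulled out of the product, what remains is the linear extension of
  \<open>f\<close> applied to (\<epsilon> \<otimes> id)\<Delta>, where the counit law
  applies.\<close>

lemma conv_unit_left: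
  assumes "\<And>x. x \<in> S \<Longrightarrow> f x \<in> free_mod S" "x \<in> S"
  shows "conv conv_unit f x = f x"
proof -
  have D: "\<Delta> (basis x) \<in> free_mod (S \<times> S)"
    using assms by (intro comult_closed basis_in_free_mod)
  have "conv conv_unit f x = lin_ext (\<odot>) (\<lambda>(a, b). \<epsilon> (basis a) \<odot> f b) (\<Delta> (basis x))"
    unfolding conv_def
  proof (rule lin_ext_cong, clarify)
    fix a b assume "(a, b) \<in> Poly_Mapping.keys (\<Delta> (basis x))"
    then have "f b \<in> free_mod S" using D assms by (auto simp: free_mod_def)
    then show "m (conv_unit a) (f b) = \<epsilon> (basis a) \<odot> f b"
      using linear_map_scale[OF mult_linear_left unit_closed] by (simp add: conv_unit_def unit_left)
  qed
  also have "\<dots> = lin_ext (\<odot>) f (tensor_lift (\<odot>) (\<lambda>y z. \<epsilon> y \<odot> z) (\<Delta> (basis x)))"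
    by (simp add: tensor_lift_def split_def lin_ext_lin_ext module_smult lin_ext_single smult_single)
  also have "\<dots> = f x"
    using assms by (simp add: counit_left basis_in_free_mod lin_ext_basis module_smult)
  finally show ?thesis .
qed

lemma conv_unit_right:
  assumes "\<And>x. x \<in> S \<Longrightarrow> f x \<in> free_mod S" "x \<in> S"
  shows "conv f conv_unit x = f x"
proof -
  have D: "\<Delta> (basis x) \<in> free_mod (S \<times> S)"
    using assms by (intro comult_closed basis_in_free_mod)
  have "conv f conv_unit x = lin_ext (\<odot>) (\<lambda>(a, b). \<epsilon> (basis b) \<odot> f a) (\<Delta> (basis x))"
    unfolding conv_def
  proof (rule lin_ext_cong, clarify)
    fix a b assume "(a, b) \<in> Poly_Mapping.keys (\<Delta> (basis x))"
    then have "f a \<in> free_mod S" using D assms by (auto simp: free_mod_def)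
    then show "m (f a) (conv_unit b) = \<epsilon> (basis b) \<odot> f a"
      using linear_map_scale[OF mult_linear_right unit_closed] by (simp add: conv_unit_def unit_right)
  qed
  also have "\<dots> = lin_ext (\<odot>) f (tensor_lift (\<odot>) (\<lambda>y z. \<epsilon> z \<odot> y) (\<Delta> (basis x)))"
    by (simp add: tensor_lift_def split_def lin_ext_lin_ext module_smult lin_ext_single smult_single)
  also have "\<dots> = f x"
    using assms by (simp add: counit_right basis_in_free_mod lin_ext_basis module_smult)
  finally show ?thesis .
qed

text \<open>Both sides are one linear map on triple tensors, \<open>triple\<close>, applied to the
  two iterated coproducts, which coassociativity identifies. Associativity of \<open>m\<close> is
  used on the left-hand side only, to bring its products into the bracketing of
  \<open>triple\<close>.\<close>

lemma conv_assoc: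
  assumes f: "\<And>x. x \<in> S \<Longrightarrow> f x \<in> free_mod S" and g: "\<And>x. x \<in> S \<Longrightarrow> g x \<in> free_mod S"
    and h: "\<And>x. x \<in> S \<Longrightarrow> h x \<in> free_mod S" and x: "x \<in> S"
  shows "conv (conv f g) h x = conv f (conv g h) x"
proof -
  define P where "P = \<Delta> (basis x)"
  define triple where
    "triple = lin_ext (\<odot>) (\<lambda>(a, b, c). m (f a) (m (g b) (h c)))"
  have D: "\<Delta> (basis y) \<in> free_mod (S \<times> S)" if "y \<in> S" for y
    using that by (intro comult_closed basis_in_free_mod)
  have P: "(a, b) \<in> Poly_Mapping.keys P \<Longrightarrow> a \<in> S \<and> b \<in> S" for a b
    using D[OF x] by (auto simp: P_def free_mod_def)
  have "conv (conv f g) h x = triple (tensor_assoc (tensor_map \<Delta> (\<lambda>y. y) P))"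
  proof -
    have "m (conv f g a) (h b) =
        lin_ext (\<odot>) (\<lambda>(p, q). m (f p) (m (g q) (h b))) (\<Delta> (basis a))"
      if "a \<in> S" "b \<in> S" for a b
    proof -
      have "m (conv f g a) (h b) =
          lin_ext (\<odot>) (\<lambda>c. m (case c of (p, q) \<Rightarrow> m (f p) (g q)) (h b)) (\<Delta> (basis a))"
        unfolding conv_def
        by (rule linear_map_lin_ext_comp[OF mult_linear_left[OF h[OF that(2)]] module_smult
              D[OF that(1)]])
          (auto intro: mult_closed f g)
      also have "\<dots> = lin_ext (\<odot>) (\<lambda>(p, q). m (f p) (m (g q) (h b))) (\<Delta> (basis a))"
        by (rule lin_ext_cong)
          (use D[OF that(1)] that in \<open>auto simp: free_mod_def[of "_ \<times> _"] mult_assoc f g h\<close>)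
      finally show ?thesis .
    qed
    then have "conv (conv f g) h x = lin_ext (\<odot>) (\<lambda>(a, b).
        lin_ext (\<odot>) (\<lambda>(p, q). m (f p) (m (g q) (h b))) (\<Delta> (basis a))) P"
      unfolding conv_def[of "conv f g"] P_def[symmetric] by (intro lin_ext_cong) (auto dest: P)
    also have "\<dots> = triple (tensor_assoc (tensor_map \<Delta> (\<lambda>y. y) P))"
      by (simp add: triple_def tensor_assoc_def tensor_map_eq split_def lin_ext_lin_ext
          lin_ext_tensor lin_ext_basis module_smult)
    finally show ?thesis .
  qed
  moreover have "conv f (conv g h) x = triple (tensor_map (\<lambda>y. y) \<Delta> P)"
  proof -
    have "m (f a) (conv g h b) =
        lin_ext (\<odot>) (\<lambda>(p, q). m (f a) (m (g p) (h q))) (\<Delta> (basis b))"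
      if "a \<in> S" "b \<in> S" for a b
      unfolding conv_def split_def
      by (rule linear_map_lin_ext_comp[OF mult_linear_right[OF f[OF that(1)]] module_smult
            D[OF that(2)]])
        (auto simp: mult_closed g h)
    then have "conv f (conv g h) x = lin_ext (\<odot>) (\<lambda>(a, b).
        lin_ext (\<odot>) (\<lambda>(p, q). m (f a) (m (g p) (h q))) (\<Delta> (basis b))) P"
      unfolding conv_def[of f] P_def[symmetric] by (intro lin_ext_cong) (auto dest: P)
    also have "\<dots> = triple (tensor_map (\<lambda>y. y) \<Delta> P)"
      by (simp add: triple_def tensor_map_eq split_def lin_ext_lin_ext
          lin_ext_tensor lin_ext_basis module_smult)
    finally show ?thesis .
  qed
  ultimately show ?thesis
    using coassoc[of "basis x"] x by (simp add: P_def basis_in_free_mod)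
qed

text \<open>The powers are built by multiplying on the left; an inverse on both sides also requires
  splitting off a factor on the right.\<close>

lemma defect_pow_Suc_right:
  "x \<in> S \<Longrightarrow> defect_pow (Suc k) x = conv (defect_pow k) defect x"
proof (induction k arbitrary: x)
  case 0
  then show ?case by (simp add: conv_unit_left conv_unit_right defect_closed)
next
  case (Suc k)
  have "defect_pow (Suc (Suc k)) x = conv defect (conv (defect_pow k) defect) x"
    using Suc by (auto intro: conv_cong)
  also have "\<dots> = conv (conv defect (defect_pow k)) defect x"
    using Suc by (simp add: conv_assoc defect_closed defect_pow_closed)
  finally show ?case by simp
qed

section \<open>The geometric series and its error term\<close>

lemma conv_diff_left:
  assumes f: "\<And>x. x \<in> S \<Longrightarrow> f x \<in> free_mod S" and g: "\<And>x. x \<in> S \<Longrightarrow> g x \<in> free_mod S"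
    and h: "\<And>x. x \<in> S \<Longrightarrow> h x \<in> free_mod S" and x: "x \<in> S"
  shows "conv (\<lambda>a. f a - g a) h x = conv f h x - conv g h x"
proof -
  have "conv (\<lambda>a. f a - g a) h x =
      lin_ext (\<odot>) (\<lambda>c. (case c of (a, b) \<Rightarrow> m (f a) (h b)) - (case c of (a, b) \<Rightarrow> m (g a) (h b)))
        (\<Delta> (basis x))"
    unfolding conv_def
    by (rule lin_ext_cong) (use comult_closed[OF basis_in_free_mod[OF x]] in
        \<open>auto simp: free_mod_def[of "_ \<times> _"] mult_diff_left f g h\<close>)
  then show ?thesis by (simp add: conv_def lin_ext_fun_diff module_smult)
qed

lemma conv_diff_right:
  assumes f: "\<And>x. x \<in> S \<Longrightarrow> f x \<in> free_mod S" and g: "\<And>x. x \<in> S \<Longrightarrow> g x \<in> free_mod S"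
    and h: "\<And>x. x \<in> S \<Longrightarrow> h x \<in> free_mod S" and x: "x \<in> S"
  shows "conv h (\<lambda>a. f a - g a) x = conv h f x - conv h g x"
proof -
  have "conv h (\<lambda>a. f a - g a) x =
      lin_ext (\<odot>) (\<lambda>c. (case c of (a, b) \<Rightarrow> m (h a) (f b)) - (case c of (a, b) \<Rightarrow> m (h a) (g b)))
        (\<Delta> (basis x))"
    unfolding conv_def
    by (rule lin_ext_cong) (use comult_closed[OF basis_in_free_mod[OF x]] in
        \<open>auto simp: free_mod_def[of "_ \<times> _"] mult_diff_right f g h\<close>)
  then show ?thesis by (simp add: conv_def lin_ext_fun_diff module_smult)
qed

definition defect_sum :: "nat \<Rightarrow> 'b \<Rightarrow> ('b \<Rightarrow>\<^sub>0 'k)"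
  where "defect_sum N x = (\<Sum>k\<le>N. defect_pow k x)"

lemma defect_sum_closed: "x \<in> S \<Longrightarrow> defect_sum N x \<in> free_mod S"
  unfolding defect_sum_def by (intro free_mod_sum defect_pow_closed)

text \<open>Written as a difference so that \<open>conv_diff_left\<close> and
  \<open>conv_diff_right\<close> apply; the recursion for the partial sums follows by moving a term
  to the other side.\<close>

lemma defect_sum_Suc_diff: "defect_sum N = (\<lambda>x. defect_sum (Suc N) x - defect_pow (Suc N) x)"
  by (simp add: fun_eq_iff defect_sum_def)

text \<open>
  The geometric series of \<open>defect\<close> inverts the identity map \<open>conv_unit - defect\<close> up to the
  last term.
\<close>

lemma conv_basis_defect_sum:
  assumes x: "x \<in> S"
  shows "conv basis (defect_sum N) x = conv_unit x - defect_pow (Suc N) x"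
    and "conv (defect_sum N) basis x = conv_unit x - defect_pow (Suc N) x"
proof -
  have left: "conv basis f x = f x - conv defect f x" and right: "conv f basis x = f x - conv f defect x"
    if "\<And>x. x \<in> S \<Longrightarrow> f x \<in> free_mod S" for f
  proof -
    have "conv basis f x = conv (\<lambda>x. conv_unit x - defect x) f x"
      by (simp add: defect_def)
    also have "\<dots> = conv conv_unit f x - conv defect f x"
      by (rule conv_diff_left[OF conv_unit_closed defect_closed that x])
    finally show "conv basis f x = f x - conv defect f x"
      by (simp only: conv_unit_left[OF that x])
    have "conv f basis x = conv f (\<lambda>x. conv_unit x - defect x) x"
      by (simp add: defect_def)
    also have "\<dots> = conv f conv_unit x - conv f defect x"
      by (rule conv_diff_right[OF conv_unit_closed defect_closed that x])
    finally show "conv f basis x = f x - conv f defect x"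
      by (simp only: conv_unit_right[OF that x])
  qed
  \<comment> \<open>The identity map is \<open>conv_unit - defect\<close>, so its convolution with a
    power is a difference of consecutive powers, and the sum over \<open>k\<close>
    telescopes.\<close>
  have pow: "conv basis (defect_pow k) x = defect_pow k x - defect_pow (Suc k) x"
    "conv (defect_pow k) basis x = defect_pow k x - defect_pow (Suc k) x" for k
    using left[of "defect_pow k"] right[of "defect_pow k"] defect_pow_Suc_right[OF x, of k]
    by (simp_all only: defect_pow_closed defect_pow.simps(2))
  have zero: "defect_sum 0 = conv_unit"
    by (simp add: fun_eq_iff defect_sum_def)
  note pow0 = pow[of 0, unfolded defect_pow.simps(1)]
  have sum_right:
    "conv basis (defect_sum N) x = conv basis (defect_sum (Suc N)) x - conv basis (defect_pow (Suc N)) x"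
    for N
    unfolding defect_sum_Suc_diff[of N]
    by (rule conv_diff_right[where f = "defect_sum (Suc N)" and g = "defect_pow (Suc N)" and h = basis,
          OF defect_sum_closed defect_pow_closed basis_in_free_mod x])
  have sum_right:
    "conv basis (defect_sum (Suc N)) x = conv basis (defect_sum N) x + conv basis (defect_pow (Suc N)) x"
    for N using sum_right[of N] by simp
  have sum_left:
    "conv (defect_sum N) basis x = conv (defect_sum (Suc N)) basis x - conv (defect_pow (Suc N)) basis x"
    for N
    unfolding defect_sum_Suc_diff[of N]
    by (rule conv_diff_left[where f = "defect_sum (Suc N)" and g = "defect_pow (Suc N)" and h = basis,
          OF defect_sum_closed defect_pow_closed basis_in_free_mod x])
  have sum_left:
    "conv (defect_sum (Suc N)) basis x = conv (defect_sum N) basis x + conv (defect_pow (Suc N)) basis x"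
    for N using sum_left[of N] by simp
  show "conv basis (defect_sum N) x = conv_unit x - defect_pow (Suc N) x"
    by (induction N) (simp_all add: zero pow0 pow sum_right del: defect_pow.simps)
  show "conv (defect_sum N) basis x = conv_unit x - defect_pow (Suc N) x"
    by (induction N) (simp_all add: zero pow0 pow sum_left del: defect_pow.simps)
qed

lemma lin_ext_conv:
  assumes "x \<in> free_mod S"
  shows "lin_ext (\<odot>) (conv f g) x = lin_ext (\<odot>) (\<lambda>(a, b). m (f a) (g b)) (\<Delta> x)"
proof -
  have "\<Delta> x = lin_ext (\<odot>) (\<lambda>b. \<Delta> (basis b)) x"
    by (rule linear_map_lin_ext[OF comult_linear module_smult assms])
  then show ?thesis
    by (simp add: conv_def[abs_def] lin_ext_lin_ext module_smult)
qed

lemma lin_ext_conv_unit: "x \<in> free_mod S \<Longrightarrow> lin_ext (\<odot>) conv_unit x = \<epsilon> x \<odot> e"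
  using linear_map_lin_ext[OF counit_linear module_mult, of x]
  by (simp add: conv_unit_def[abs_def] lin_ext_def module.scale_sum_left[OF module_smult]
      module.scale_scale[OF module_smult])

end

text \<open>The coaugmentation is built from the unit \<open>e\<close> of the algebra. This is the
  link between the two structures: degree \<open>0\<close> then consists of the multiples of
  \<open>e\<close>.\<close>

locale connected_cofiltered_bialgebra =
  bialgebra S m e \<Delta> \<epsilon> + connected_cofiltered_coaugmented_coalgebra S \<Delta> \<epsilon> "\<lambda>c. c \<odot> e" F
  for S :: "'b set" and m :: "('b \<Rightarrow>\<^sub>0 'k::comm_ring_1) \<Rightarrow> _" and e and \<Delta> and \<epsilon> and F
begin

lemma filt_subset: "F n \<subseteq> free_mod S"
  using filt_exhaustive by blast

text \<open>By connectedness \<open>x = c \<odot> e\<close>, and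
  \<open>\<epsilon> (c \<odot> e) = c\<close> because \<open>c \<odot> e\<close> is the
  coaugmentation of \<open>c\<close>.\<close>

lemma lin_ext_defect_zero:
  assumes "x \<in> F 0"
  shows "lin_ext (\<odot>) defect x = 0"
proof -
  obtain c where x: "x = c \<odot> e" using assms connected by auto
  have "lin_ext (\<odot>) defect x = \<epsilon> x \<odot> e - x"
    using lin_ext_conv_unit[of x] filt_subset assms
    by (auto simp: defect_def[abs_def] lin_ext_fun_diff module_smult lin_ext_basis_id)
  then show ?thesis
    by (simp add: x counit_coaug)
qed

text \<open>
  By induction on \<open>k\<close>: the coproduct of an element of \<open>F k\<close> is a sum of pure tensors whose right
  factor is in some \<open>F q\<close> with \<open>q < k\<close>, or whose left factor is in \<open>F 0\<close> and killed by \<open>defect\<close>.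
\<close>

lemma lin_ext_defect_pow_zero:
  assumes "x \<in> F n" "n < k"
  shows "lin_ext (\<odot>) (defect_pow k) x = 0"
  using assms
proof (induction k arbitrary: x n)
  case (Suc k)
  interpret M: module "(\<odot>) :: 'k \<Rightarrow> ('b \<times> 'b \<Rightarrow>\<^sub>0 'k) \<Rightarrow> _" by (rule module_smult)
  let ?h = "lin_ext (\<odot>) (\<lambda>(a, b). m (defect a) (defect_pow k b))"
  have tensor: "?h (y \<otimes> z) = m (lin_ext (\<odot>) defect y) (lin_ext (\<odot>) (defect_pow k) z)"
    if y: "y \<in> free_mod S" and z: "z \<in> free_mod S" for y z
  proof -
    have z': "lin_ext (\<odot>) (defect_pow k) z \<in> free_mod S"
      by (rule lin_ext_closed[OF z defect_pow_closed])
    have "m (lin_ext (\<odot>) defect y) (lin_ext (\<odot>) (defect_pow k) z) =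
        lin_ext (\<odot>) (\<lambda>a. m (defect a) (lin_ext (\<odot>) (defect_pow k) z)) y"
      by (rule linear_map_lin_ext_comp[OF mult_linear_left[OF z'] module_smult y defect_closed])
    also have "\<dots> = lin_ext (\<odot>) (\<lambda>a. lin_ext (\<odot>) (\<lambda>b. m (defect a) (defect_pow k b)) z) y"
    proof (rule lin_ext_cong)
      fix a assume "a \<in> Poly_Mapping.keys y"
      then have "defect a \<in> free_mod S"
        using y by (intro defect_closed) (auto simp: free_mod_def)
      then show "m (defect a) (lin_ext (\<odot>) (defect_pow k) z) =
          lin_ext (\<odot>) (\<lambda>b. m (defect a) (defect_pow k b)) z"
        by (rule linear_map_lin_ext_comp[OF mult_linear_right module_smult z defect_pow_closed])
    qed
    also have "\<dots> = ?h (y \<otimes> z)"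
      by (simp add: lin_ext_tensor module_smult)
    finally show ?thesis by simp
  qed
  have "\<Delta> x \<in> M.span (\<Union>(p, q) \<in> {(p, q). p + q = n}. {y \<otimes> z | y z. y \<in> F p \<and> z \<in> F q})"
    using comult_filt Suc.prems by blast
  then have "?h (\<Delta> x) = 0"
  proof (rule module_hom.eq_0_on_span[OF module_hom_lin_ext[OF module_smult], rotated])
    fix P assume "P \<in> (\<Union>(p, q) \<in> {(p, q). p + q = n}. {y \<otimes> z | y z. y \<in> F p \<and> z \<in> F q})"
    then obtain p q y z where P: "P = y \<otimes> z" "p + q = n" "y \<in> F p" "z \<in> F q" by auto
    have yz: "y \<in> free_mod S" "z \<in> free_mod S" using P filt_subset by auto
    have zero: "m 0 w = 0" "m w 0 = 0" if "w \<in> free_mod S" for w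
      using mult_diff_left[of w w w] mult_diff_right[of w w w] that by auto
    show "?h P = 0"
    proof (cases "q < k")
      case True
      then show ?thesis
        using P yz Suc.IH[of z q] lin_ext_closed[OF yz(1) defect_closed] by (simp add: tensor zero)
    next
      case False
      \<comment> \<open>The bounds meet exactly: \<open>n \<le> k\<close> and
        \<open>k \<le> q\<close> leave nothing for the left factor.\<close>
      with P(2) Suc.prems(2) have "p = 0" by simp
      with P(3) have "y \<in> F 0" by simp
      then show ?thesis
        using P yz lin_ext_closed[OF yz(2) defect_pow_closed[of _ k]]
        by (simp add: tensor zero lin_ext_defect_zero)
    qed
  qed
  moreover have "x \<in> free_mod S"
    using Suc.prems(1) filt_subset by blast
  ultimately show ?case
    by (simp add: lin_ext_conv)
qed simp

text \<open>For \<open>x\<close> in \<open>S\<close> exhaustiveness provides such an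
  \<open>n\<close>, and only these \<open>x\<close> are considered. The filtration is not assumed to
  be spanned by basis elements; the degree serves only as a place to cut the series.\<close>

definition filt_degree :: "'b \<Rightarrow> nat"
  where "filt_degree x = (LEAST n. basis x \<in> F n)"

text \<open>The length of the series depends on the element. Choosing it on basis elements and
  extending linearly makes linearity automatic.\<close>

definition antipode_map :: "('b \<Rightarrow>\<^sub>0 'k) \<Rightarrow> ('b \<Rightarrow>\<^sub>0 'k)"
  where "antipode_map = lin_ext (\<odot>) (\<lambda>x. defect_sum (filt_degree x) x)"

lemma defect_pow_zero:
  assumes "x \<in> S" "filt_degree x < k"
  shows "defect_pow k x = 0"
proof -
  have "\<exists>n. basis x \<in> F n"
    using basis_in_free_mod[OF assms(1)] filt_exhaustive by blast
  then have "basis x \<in> F (filt_degree x)"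
    unfolding filt_degree_def by (rule LeastI_ex)
  from lin_ext_defect_pow_zero[OF this assms(2)] show ?thesis
    by (simp add: lin_ext_basis module_smult)
qed

text \<open>The additional powers vanish on \<open>x\<close>. The freedom in \<open>N\<close> allows
  a single length for all basis elements that occur in one coproduct.\<close>

lemma antipode_map_basis:
  assumes "x \<in> S" "filt_degree x \<le> N"
  shows "antipode_map (basis x) = defect_sum N x"
proof -
  have "defect_sum (filt_degree x) x = defect_sum N x"
    unfolding defect_sum_def
    by (rule sum.mono_neutral_left) (use assms in \<open>auto intro: defect_pow_zero\<close>)
  then show ?thesis by (simp add: antipode_map_def lin_ext_basis module_smult)
qed

lemma conv_antipode_map:
  assumes x: "x \<in> S"
  shows "conv (\<lambda>b. antipode_map (basis b)) basis x = conv_unit x"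
    and "conv basis (\<lambda>b. antipode_map (basis b)) x = conv_unit x"
proof -
  \<comment> \<open>The finitely many tensor factors in the coproduct of \<open>x\<close> get a
    common length \<open>N\<close>. Including \<open>x\<close> itself makes the error term
    \<open>defect_pow (Suc N) x\<close> vanish.\<close>
  define B where "B = insert x (fst ` Poly_Mapping.keys (\<Delta> (basis x)) \<union> snd ` Poly_Mapping.keys (\<Delta> (basis x)))"
  define N where "N = Max (filt_degree ` B)"
  have N: "filt_degree b \<le> N" if "b \<in> B" for b
    unfolding N_def by (rule Max_ge) (use that in \<open>auto simp: B_def\<close>)
  have A: "antipode_map (basis b) = defect_sum N b" if "b \<in> B" for b
    using that comult_closed[OF basis_in_free_mod[OF x]] x
    by (intro antipode_map_basis N) (auto simp: B_def free_mod_def)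
  have "defect_pow (Suc N) x = 0"
    using N[of x] by (intro defect_pow_zero[OF x]) (simp add: B_def)
  moreover have "conv (\<lambda>b. antipode_map (basis b)) basis x = conv (defect_sum N) basis x"
    unfolding conv_def by (rule lin_ext_cong) (clarsimp, subst A, force simp: B_def, rule refl)
  moreover have "conv basis (\<lambda>b. antipode_map (basis b)) x = conv basis (defect_sum N) x"
    unfolding conv_def by (rule lin_ext_cong) (clarsimp, subst A, force simp: B_def, rule refl)
  ultimately show "conv (\<lambda>b. antipode_map (basis b)) basis x = conv_unit x"
    and "conv basis (\<lambda>b. antipode_map (basis b)) x = conv_unit x"
    using conv_basis_defect_sum[OF x] by (simp_all del: defect_pow.simps)
qed

theorem hopf: "hopf_algebra S m e \<Delta> \<epsilon>"
proof unfold_locales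
  have "linear_map (\<odot>) (\<odot>) (free_mod S) (free_mod S) antipode_map"
    unfolding antipode_map_def by (intro linear_map_lin_ext_into defect_sum_closed)
  moreover have "tensor_lift (\<odot>) (\<lambda>y z. m (antipode_map y) z) (\<Delta> x) = \<epsilon> x \<odot> e"
    "tensor_lift (\<odot>) (\<lambda>y z. m y (antipode_map z)) (\<Delta> x) = \<epsilon> x \<odot> e"
    if x: "x \<in> free_mod S" for x
  proof -
    have "lin_ext (\<odot>) (conv f g) x = \<epsilon> x \<odot> e" if "\<And>b. b \<in> S \<Longrightarrow> conv f g b = conv_unit b" for f g
      using x that lin_ext_cong[of x "conv f g" conv_unit "(\<odot>)"]
      by (simp add: lin_ext_conv_unit free_mod_def subset_iff)
    from this[of "\<lambda>b. antipode_map (basis b)" basis] this[of basis "\<lambda>b. antipode_map (basis b)"]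
    show "tensor_lift (\<odot>) (\<lambda>y z. m (antipode_map y) z) (\<Delta> x) = \<epsilon> x \<odot> e"
      "tensor_lift (\<odot>) (\<lambda>y z. m y (antipode_map z)) (\<Delta> x) = \<epsilon> x \<odot> e"
      using x by (simp_all add: lin_ext_conv conv_antipode_map tensor_lift_def)
  qed
  ultimately show "\<exists>A. linear_map (\<odot>) (\<odot>) (free_mod S) (free_mod S) A \<and>
    (\<forall>x\<in>free_mod S.
      tensor_lift (\<odot>) (\<lambda>y z. m (A y) z) (\<Delta> x) = \<epsilon> x \<odot> e \<and>
      tensor_lift (\<odot>) (\<lambda>y z. m y (A z)) (\<Delta> x) = \<epsilon> x \<odot> e)"
    by blast
qed

end

section \<open>The bialgebra of decorated planar forests\<close>

text \<open>A scalar acts as multiplication by \<open>Poly_Mapping.single 0 c\<close>, which is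
  central because the ground ring is commutative and \<open>0\<close> is neutral in the
  monoid.\<close>

lemma smult_times: "(c \<odot> p) * q = c \<odot> (p * q)"
  and times_smult: "p * (c \<odot> q) = c \<odot> (p * q)"
  for p q :: "'b::monoid_add \<Rightarrow>\<^sub>0 'k::comm_ring_1"
proof -
  have smult: "c \<odot> r = Poly_Mapping.single 0 c * r" for r :: "'b \<Rightarrow>\<^sub>0 'k"
    by (simp add: smult_def mult_map_scale_conv_mult)
  then show "(c \<odot> p) * q = c \<odot> (p * q)"
    by (simp add: mult.assoc)
  have comm: "p * Poly_Mapping.single 0 c = Poly_Mapping.single 0 c * p"
    by (subst (1 2) expand_single[of p])
      (simp add: sum_distrib_left sum_distrib_right mult_single mult.commute)
  have "p * (c \<odot> q) = (p * Poly_Mapping.single 0 c) * q"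
    by (simp only: smult mult.assoc)
  also have "\<dots> = c \<odot> (p * q)"
    by (simp only: comm smult mult.assoc)
  finally show "p * (c \<odot> q) = c \<odot> (p * q)" .
qed

lemma module_hom_times_left: "module_hom (\<odot>) (\<odot>) (\<lambda>p. p * q)"
  and module_hom_times_right: "module_hom (\<odot>) (\<odot>) (\<lambda>q. p * q)"
  for p q :: "'b::monoid_add \<Rightarrow>\<^sub>0 'k::comm_ring_1"
  by (simp_all add: module_hom_iff module_smult distrib_left distrib_right smult_times times_smult)

lemma times_eq_lin_ext:
  fixes p q :: "'b::monoid_add \<Rightarrow>\<^sub>0 'k::comm_ring_1"
  shows "p * q = lin_ext (\<odot>) (\<lambda>a. lin_ext (\<odot>) (\<lambda>b. basis (a + b)) q) p"
proof -
  have "basis a * q = lin_ext (\<odot>) (\<lambda>b. basis (a + b)) q" for a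
    using module_hom_lin_ext_comp[OF module_hom_times_right, of "basis a" basis q]
    by (simp only: lin_ext_basis_id mult_single mult_1)
  then show ?thesis
    using module_hom_lin_ext_comp[OF module_hom_times_left, of basis p q]
    by (simp only: lin_ext_basis_id)
qed

lemma free_mod_times:
  assumes "p \<in> free_mod A" "q \<in> free_mod B" "\<And>a b. a \<in> A \<Longrightarrow> b \<in> B \<Longrightarrow> a + b \<in> C"
  shows "p * q \<in> free_mod C"
  unfolding times_eq_lin_ext using assms by (intro lin_ext_closed basis_in_free_mod)

text \<open>The universal property of a monoid algebra: a multiplicative map on the monoid extends
  to a multiplicative linear map. The target is a general ring, so that it covers the counit as well
  as the coproduct.\<close>

lemma lin_ext_times:
  fixes s :: "'k::comm_ring_1 \<Rightarrow> 'r::ring \<Rightarrow> 'r" and f :: "'b::monoid_add \<Rightarrow> 'r"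
  assumes s: "module s" and left: "\<And>c x y. s c x * y = s c (x * y)"
    and right: "\<And>c x y. x * s c y = s c (x * y)"
    and f: "\<And>a b. f (a + b) = f a * f b"
  shows "lin_ext s f (p * q) = lin_ext s f p * lin_ext s f q"
proof -
  have 1: "module_hom s s (\<lambda>x. x * y)" "module_hom s s (\<lambda>x. y * x)" for y
    using s by (simp_all add: module_hom_iff distrib_left distrib_right left right)
  have "lin_ext s f (p * q) = lin_ext s (\<lambda>a. lin_ext s (\<lambda>b. f a * f b) q) p"
    by (simp only: times_eq_lin_ext lin_ext_lin_ext[OF s] lin_ext_basis[OF s] f)
  also have "\<dots> = lin_ext s f p * lin_ext s f q"
    by (simp only: module_hom_lin_ext_comp[OF 1(1)], simp only: module_hom_lin_ext_comp[OF 1(2)])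
  finally show ?thesis .
qed

lemmas lin_ext_smult_times = lin_ext_times[OF module_smult smult_times times_smult]

lemma lin_ext_swap:
  assumes "module s"
  shows "lin_ext s (\<lambda>a. lin_ext s (f a) q) p = lin_ext s (\<lambda>b. lin_ext s (\<lambda>a. f a b) p) q"
proof -
  interpret module s by fact
  show ?thesis
    unfolding lin_ext_def scale_sum_right
    by (subst sum.swap) (simp add: scale_scale mult.commute)
qed

text \<open>After expansion in the basis the two sides differ by exchanging the sums over
  \<open>b\<close> and \<open>c\<close>. The factors may belong to different monoids, since in
  coassociativity one of them is itself a tensor square.\<close>

lemma tensor_times_tensor:
  fixes a c :: "'b::monoid_add \<Rightarrow>\<^sub>0 'k::comm_ring_1" and b d :: "'c::monoid_add \<Rightarrow>\<^sub>0 'k"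
  shows "(a \<otimes> b) * (c \<otimes> d) = (a * c) \<otimes> (b * d)"
proof -
  have "(a \<otimes> b) * (c \<otimes> d) = lin_ext (\<odot>) (\<lambda>w. lin_ext (\<odot>) (\<lambda>x. lin_ext (\<odot>) (\<lambda>y.
      lin_ext (\<odot>) (\<lambda>z. basis (w + y, x + z)) d) c) b) a"
    by (simp only: times_eq_lin_ext[of "a \<otimes> b"] lin_ext_tensor[OF module_smult] plus_prod_def
        fst_conv snd_conv)
  also have "\<dots> = lin_ext (\<odot>) (\<lambda>w. lin_ext (\<odot>) (\<lambda>y. lin_ext (\<odot>) (\<lambda>x.
      lin_ext (\<odot>) (\<lambda>z. basis (w + y, x + z)) d) b) c) a"
    by (subst lin_ext_swap[OF module_smult, of _ c b]) (rule refl)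
  also have "\<dots> = lin_ext (\<odot>) basis ((a * c) \<otimes> (b * d))"
    by (simp only: times_eq_lin_ext lin_ext_tensor[OF module_smult] lin_ext_lin_ext[OF module_smult]
        lin_ext_basis[OF module_smult])
  finally show ?thesis
    by (simp only: lin_ext_basis_id)
qed

lemma one_tensor_one: "(1 :: 'b::monoid_add \<Rightarrow>\<^sub>0 'k::comm_ring_1) \<otimes> (1 :: 'c::monoid_add \<Rightarrow>\<^sub>0 'k) = 1"
  by (simp add: basis_tensor zero_prod_def flip: single_one)

text \<open>The mutual induction on trees and forests becomes one on forests by reading a tree as a
  forest of length one. The \<open>Cons\<close> case then is the product of two forests and the
  \<open>Node\<close> case is the grafting, leaves included.\<close>

lemma forest_induct [case_names Nil Node Cons]:
  assumes "P []" and "\<And>a F. P F \<Longrightarrow> P [Node a F]" and "\<And>T F. P [T] \<Longrightarrow> P F \<Longrightarrow> P (T # F)"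
  shows "P F"
proof -
  have "P F" if "\<And>T. T \<in> set F \<Longrightarrow> P [T]" for F
    using that by (induction F) (auto intro: assms)
  moreover from this have "P [T]" for T
    by (induction T) (auto intro: assms)
  ultimately show ?thesis by blast
qed

lemma comult_forest_Node:
  "comult_forest X \<mu> lam [Node a F] =
    (if a \<in> X then basis [Node a F] \<otimes> 1 + 1 \<otimes> basis [Node a F] + \<mu> a \<odot> (1 \<otimes> 1)
     else basis [Node a F] \<otimes> 1 + tensor_map (\<lambda>x. x) (graft a) (comult_forest X \<mu> lam F)
       + lam a \<odot> (basis F \<otimes> 1))"
  by (simp add: one_tensor_one)

lemma comult_forest_append:
  "comult_forest X \<mu> lam (F @ G) = comult_forest X \<mu> lam F * comult_forest X \<mu> lam G"
  by (induction F) (simp_all add: mult.assoc one_tensor_one)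

lemma counit_forest_append:
  "counit_forest X \<mu> lam (F @ G) = counit_forest X \<mu> lam F * counit_forest X \<mu> lam G"
  by (induction F) (simp_all add: mult.assoc)

lemma comult_RT_basis: "comult_RT X \<mu> lam (basis F) = comult_forest X \<mu> lam F"
  by (simp add: comult_RT_def lin_ext_basis module_smult)

lemma counit_RT_basis: "counit_RT X \<mu> lam (basis F) = counit_forest X \<mu> lam F"
  by (simp add: counit_RT_def lin_ext_basis module_mult)

lemma comult_RT_times:
  "comult_RT X \<mu> lam (p * q) = comult_RT X \<mu> lam p * comult_RT X \<mu> lam q"
  unfolding comult_RT_def
  by (rule lin_ext_smult_times) (simp add: plus_list_def comult_forest_append)

lemma counit_RT_times:
  "counit_RT X \<mu> lam (p * q) = counit_RT X \<mu> lam p * counit_RT X \<mu> lam q"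
  unfolding counit_RT_def
  by (rule lin_ext_times[OF module_mult]) (simp_all add: plus_list_def counit_forest_append mult_ac)

lemma lin_ext_add: "module s \<Longrightarrow> lin_ext s f (p + q) = lin_ext s f p + lin_ext s f q"
  and lin_ext_smult: "module s \<Longrightarrow> lin_ext s f (c \<odot> p) = s c (lin_ext s f p)"
  using module_hom_lin_ext[of s f] by (simp_all add: module_hom_iff)

lemmas lin_ext_simps = lin_ext_add[OF module_smult] lin_ext_smult[OF module_smult]
  lin_ext_basis[OF module_smult] lin_ext_tensor[OF module_smult] lin_ext_lin_ext[OF module_smult]

lemma tensor_map_times:
  fixes f :: "('b::monoid_add \<Rightarrow>\<^sub>0 'k::comm_ring_1) \<Rightarrow> ('d::monoid_add \<Rightarrow>\<^sub>0 'k)"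
    and g :: "('c::monoid_add \<Rightarrow>\<^sub>0 'k) \<Rightarrow> ('e::monoid_add \<Rightarrow>\<^sub>0 'k)"
  assumes "\<And>a b. f (a * b) = f a * f b" "\<And>a b. g (a * b) = g a * g b"
  shows "tensor_map f g (P * Q) = tensor_map f g P * tensor_map f g Q"
  unfolding tensor_map_eq
proof (rule lin_ext_smult_times, clarify)
  fix a c :: 'b and b d :: 'c
  have "f (basis (a + c)) = f (basis a) * f (basis c)" "g (basis (b + d)) = g (basis b) * g (basis d)"
    using assms(1)[of "basis a" "basis c"] assms(2)[of "basis b" "basis d"] by (simp_all add: mult_single)
  then show "(case (a, b) + (c, d) of (a, b) \<Rightarrow> f (basis a) \<otimes> g (basis b)) =
      (f (basis a) \<otimes> g (basis b)) * (f (basis c) \<otimes> g (basis d))"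
    by (simp add: plus_prod_def tensor_times_tensor)
qed

lemma tensor_assoc_times:
  fixes P Q :: "('b::monoid_add \<times> 'c::monoid_add) \<times> 'd::monoid_add \<Rightarrow>\<^sub>0 'k::comm_ring_1"
  shows "tensor_assoc (P * Q) = tensor_assoc P * tensor_assoc Q"
  unfolding tensor_assoc_def
  by (rule lin_ext_smult_times) (auto simp: plus_prod_def mult_single)

text \<open>
  Both sides are multiplicative. On a grafted tree they differ only in their summand \<open>G\<close>, the image
  under \<open>id \<otimes> id \<otimes> graft a\<close> of the corresponding side for the branches.
\<close>

lemma coassoc_forest:
  "tensor_assoc (tensor_map (comult_RT X \<mu> lam) (\<lambda>y. y) (comult_forest X \<mu> lam F)) =
    tensor_map (\<lambda>y. y) (comult_RT X \<mu> lam) (comult_forest X \<mu> lam F)"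
proof (induction F rule: forest_induct)
  case Nil
  show ?case
    by (simp add: one_eq_basis basis_tensor tensor_map_eq tensor_assoc_def comult_RT_basis lin_ext_simps)
next
  case (Cons T F)
  let ?L = "\<lambda>P. tensor_assoc (tensor_map (comult_RT X \<mu> lam) (\<lambda>y. y) P)"
    and ?R = "tensor_map (\<lambda>y. y) (comult_RT X \<mu> lam)"
  have mult: "?L (P * Q) = ?L P * ?L Q" "?R (P * Q) = ?R P * ?R Q" for P Q
    by (simp_all only: tensor_map_times tensor_assoc_times comult_RT_times)
  have "comult_forest X \<mu> lam (T # F) = comult_forest X \<mu> lam [T] * comult_forest X \<mu> lam F"
    using comult_forest_append[of X \<mu> lam "[T]" F] by simp
  then show ?case
    using Cons.IH by (simp only: mult)
next
  case (Node a F)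
  show ?case
  proof (cases "a \<in> X")
    case True
    then show ?thesis
      by (simp add: one_eq_basis basis_tensor tensor_map_eq tensor_assoc_def comult_RT_basis
          lin_ext_simps comult_forest_Node tensor_add_left tensor_add_right tensor_smult_left
          tensor_smult_right module.scale_right_distrib[OF module_smult] algebra_simps
          del: comult_forest.simps(2))
  next
    case False
    let ?P = "comult_forest X \<mu> lam F"
    define G :: "('a ptree list \<times> 'a ptree list \<times> 'a ptree list \<Rightarrow>\<^sub>0 'b) \<Rightarrow> _"
      where "G = lin_ext (\<odot>) (\<lambda>(b, c, d). basis (b, c, [Node a d]))"
    \<comment> \<open>On the left, the last two sums come from the coproduct of the grafted tree
      tensored with \<open>1\<close> and from \<open>lam a\<close> times the coproduct of
      \<open>F\<close> tensored with \<open>1\<close>. On the right, both come from the coproduct of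
      the grafted right factors.\<close>
    define K :: "'a ptree list \<times> 'a ptree list \<times> 'a ptree list \<Rightarrow>\<^sub>0 'b"
      where "K = basis ([Node a F], [], []) + lam a \<odot> basis (F, [], [])
      + lin_ext (\<odot>) (\<lambda>(b, c). basis (b, [Node a c], [])) ?P
      + lam a \<odot> lin_ext (\<odot>) (\<lambda>(b, c). basis (b, c, [])) ?P"
    note unfold = split_def one_eq_basis basis_tensor tensor_map_eq tensor_assoc_def comult_RT_basis
      graft_basis lin_ext_simps comult_forest_Node tensor_add_left tensor_add_right
      tensor_smult_left tensor_smult_right lin_ext_tensor_left lin_ext_tensor_right
      lin_ext_fun_add[OF module_smult] lin_ext_fun_scale[OF module_smult]
    have "tensor_assoc (tensor_map (comult_RT X \<mu> lam) (\<lambda>y. y) (comult_forest X \<mu> lam [Node a F])) =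
        K + G (tensor_assoc (tensor_map (comult_RT X \<mu> lam) (\<lambda>y. y) ?P))"
      unfolding K_def G_def using False
      by (simp add: unfold del: comult_forest.simps(2))
    moreover have "tensor_map (\<lambda>y. y) (comult_RT X \<mu> lam) (comult_forest X \<mu> lam [Node a F]) =
        K + G (tensor_map (\<lambda>y. y) (comult_RT X \<mu> lam) ?P)"
      unfolding K_def G_def using False
      by (simp add: unfold del: comult_forest.simps(2))
    ultimately show ?thesis
      by (simp only: Node.IH)
  qed
qed

text \<open>Grafting acts on the right factor and so commutes with \<epsilon> on the left one: the
  middle term already gives the grafted tree. The two outer terms cancel by the sign in the counit.
  For a leaf in \<open>X\<close> the term with \<open>\<mu>\<close> cancels in the same way.\<close>

lemma counit_left_forest:
  "tensor_lift (\<odot>) (\<lambda>y z. counit_RT X \<mu> lam y \<odot> z) (comult_forest X \<mu> lam F) = basis F"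
    (is "tensor_lift _ ?f _ = _")
proof (induction F rule: forest_induct)
  case Nil
  show ?case
    by (simp add: tensor_lift_def one_eq_basis basis_tensor counit_RT_basis lin_ext_simps
        module.scale_one[OF module_smult])
next
  case (Cons T F)
  have mult: "tensor_lift (\<odot>) ?f (P * Q) = tensor_lift (\<odot>) ?f P * tensor_lift (\<odot>) ?f Q" for P Q
    unfolding tensor_lift_def
    by (rule lin_ext_smult_times)
      (auto simp: plus_prod_def plus_list_def counit_RT_basis counit_forest_append smult_single
        mult_single)
  have "comult_forest X \<mu> lam (T # F) = comult_forest X \<mu> lam [T] * comult_forest X \<mu> lam F"
    using comult_forest_append[of X \<mu> lam "[T]" F] by simp
  then show ?case
    using Cons.IH by (simp add: mult basis_mult del: comult_forest.simps)
next
  case (Node a F)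
  have "tensor_lift (\<odot>) ?f (tensor_map (\<lambda>y. y) (graft a) (comult_forest X \<mu> lam F)) =
      graft a (tensor_lift (\<odot>) ?f (comult_forest X \<mu> lam F))"
    by (simp add: tensor_lift_def tensor_map_eq graft_def split_def basis_tensor counit_RT_basis
        lin_ext_simps)
  then have graft: "tensor_lift (\<odot>) ?f (tensor_map (\<lambda>y. y) (graft a) (comult_forest X \<mu> lam F)) = basis [Node a F]"
    by (simp add: Node.IH graft_basis)
  have add: "tensor_lift (\<odot>) ?f (P + Q) = tensor_lift (\<odot>) ?f P + tensor_lift (\<odot>) ?f Q"
    and smult: "tensor_lift (\<odot>) ?f (c \<odot> P) = c \<odot> tensor_lift (\<odot>) ?f P" for P Q c
    by (simp_all add: tensor_lift_def lin_ext_simps)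
  have single: "tensor_lift (\<odot>) ?f (Poly_Mapping.single (G, H) c) =
      Poly_Mapping.single H (c * counit_forest X \<mu> lam G)" for G H c
    by (simp add: tensor_lift_def lin_ext_single module_smult counit_RT_basis smult_single)
  show ?case
    by (simp add: comult_forest_Node add smult single graft one_eq_basis basis_tensor smult_single
        flip: single_add del: comult_forest.simps)
qed

text \<open>Here the first term gives the tree. Outside \<open>X\<close>, the counit of a grafted
  right factor contributes \<open>- lam a\<close>, so by induction the middle term is
  \<open>- lam a \<odot> basis F\<close> and cancels the last one.\<close>

lemma counit_right_forest:
  "tensor_lift (\<odot>) (\<lambda>y z. counit_RT X \<mu> lam z \<odot> y) (comult_forest X \<mu> lam F) = basis F"
    (is "tensor_lift _ ?f _ = _")
proof (induction F rule: forest_induct)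
  case Nil
  show ?case
    by (simp add: tensor_lift_def one_eq_basis basis_tensor counit_RT_basis lin_ext_simps
        module.scale_one[OF module_smult])
next
  case (Cons T F)
  have mult: "tensor_lift (\<odot>) ?f (P * Q) = tensor_lift (\<odot>) ?f P * tensor_lift (\<odot>) ?f Q" for P Q
    unfolding tensor_lift_def
    by (rule lin_ext_smult_times)
      (auto simp: plus_prod_def plus_list_def counit_RT_basis counit_forest_append smult_single
        mult_single)
  have "comult_forest X \<mu> lam (T # F) = comult_forest X \<mu> lam [T] * comult_forest X \<mu> lam F"
    using comult_forest_append[of X \<mu> lam "[T]" F] by simp
  then show ?case
    using Cons.IH by (simp add: mult basis_mult del: comult_forest.simps)
next
  case (Node a F)
  have add: "tensor_lift (\<odot>) ?f (P + Q) = tensor_lift (\<odot>) ?f P + tensor_lift (\<odot>) ?f Q"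
    and smult: "tensor_lift (\<odot>) ?f (c \<odot> P) = c \<odot> tensor_lift (\<odot>) ?f P" for P Q c
    by (simp_all add: tensor_lift_def lin_ext_simps)
  have single: "tensor_lift (\<odot>) ?f (Poly_Mapping.single (G, H) c) =
      Poly_Mapping.single G (c * counit_forest X \<mu> lam H)" for G H c
    by (simp add: tensor_lift_def lin_ext_single module_smult counit_RT_basis smult_single)
  have graft: "tensor_lift (\<odot>) ?f (tensor_map (\<lambda>y. y) (graft a) (comult_forest X \<mu> lam F)) =
      - lam a \<odot> basis F" if "a \<notin> X"
  proof -
    have "tensor_lift (\<odot>) ?f (tensor_map (\<lambda>y. y) (graft a) (comult_forest X \<mu> lam F)) =
        lin_ext (\<odot>) (\<lambda>(G, H). - lam a \<odot> (counit_forest X \<mu> lam H \<odot> basis G)) (comult_forest X \<mu> lam F)"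
      using that by (simp add: tensor_lift_def tensor_map_eq split_def basis_tensor counit_RT_basis
        graft_basis lin_ext_simps smult_single)
    also have "\<dots> = - lam a \<odot> tensor_lift (\<odot>) ?f (comult_forest X \<mu> lam F)"
      by (simp only: split_def lin_ext_fun_scale[OF module_smult] tensor_lift_def counit_RT_basis)
    finally show ?thesis
      by (simp add: Node.IH)
  qed
  show ?case
    by (simp add: comult_forest_Node add smult single graft one_eq_basis basis_tensor smult_single
        flip: single_add del: comult_forest.simps)
qed

section \<open>Decorations and the filtration by number of vertices\<close>

lemma forests_RT_simps [simp]:
  "[] \<in> forests_RT X \<Omega>"
  "T # F \<in> forests_RT X \<Omega> \<longleftrightarrow> decorated X \<Omega> T \<and> F \<in> forests_RT X \<Omega>"
  "F @ G \<in> forests_RT X \<Omega> \<longleftrightarrow> F \<in> forests_RT X \<Omega> \<and> G \<in> forests_RT X \<Omega>"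
  by (auto simp: forests_RT_def trees_RT_def)

lemma decorated_Node:
  assumes "decorated X \<Omega> (Node a F)"
  shows "F \<in> forests_RT X \<Omega>" and "a \<in> X \<or> a \<in> \<Omega>"
  using assms by (auto simp: forests_RT_def trees_RT_def split: if_splits)

lemma decorated_NodeI: "a \<in> \<Omega> \<Longrightarrow> F \<in> forests_RT X \<Omega> \<Longrightarrow> decorated X \<Omega> (Node a F)"
  by (auto simp: forests_RT_def trees_RT_def)

abbreviation weight :: "'a ptree list \<Rightarrow> nat"
  where "weight F \<equiv> \<Sum>T\<leftarrow>F. vertices T"

text \<open>Grafting adds one vertex on the right, matching the new root; only the terms with
  \<open>\<mu>\<close> and \<open>lam\<close> fall short, by one vertex. The statement also records
  that both factors stay properly decorated, which gives the codomain of the coproduct.\<close>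

lemma comult_forest_weight:
  "F \<in> forests_RT X \<Omega> \<Longrightarrow> comult_forest X \<mu> lam F \<in>
    free_mod {(G, H). G \<in> forests_RT X \<Omega> \<and> H \<in> forests_RT X \<Omega> \<and> weight G + weight H \<le> weight F}"
  (is "_ \<Longrightarrow> _ \<in> free_mod (?D F)")
proof (induction F rule: forest_induct)
  case Nil
  show ?case
    by (simp add: one_eq_basis basis_tensor basis_in_free_mod)
next
  case (Cons T F)
  have "comult_forest X \<mu> lam (T # F) = comult_forest X \<mu> lam [T] * comult_forest X \<mu> lam F"
    using comult_forest_append[of X \<mu> lam "[T]" F] by simp
  moreover have "comult_forest X \<mu> lam [T] * comult_forest X \<mu> lam F \<in> free_mod (?D (T # F))"
    by (rule free_mod_times[OF Cons.IH])
      (use Cons.prems in \<open>auto simp: plus_prod_def plus_list_def\<close>)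
  ultimately show ?case by simp
next
  case (Node a F)
  then have F: "F \<in> forests_RT X \<Omega>" and a: "a \<in> X \<or> a \<in> \<Omega>"
    using decorated_Node[of X \<Omega> a F] by auto
  show ?case
  proof (cases "a \<in> X")
    case True
    with Node.prems show ?thesis
      by (auto simp: comult_forest_Node one_eq_basis basis_tensor simp del: comult_forest.simps
          intro!: free_mod_add free_mod_smult basis_in_free_mod)
  next
    case False
    have "tensor_map (\<lambda>x. x) (graft a) (comult_forest X \<mu> lam F) \<in> free_mod (?D [Node a F])"
      unfolding tensor_map_eq
      by (rule lin_ext_closed[OF Node.IH[OF F]])
        (use False a in \<open>auto simp: graft_basis basis_tensor intro!: basis_in_free_mod decorated_NodeI
          simp del: decorated.simps\<close>)
    with False F Node.prems show ?thesis
      by (auto simp: comult_forest_Node one_eq_basis basis_tensor simp del: comult_forest.simps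
          intro!: free_mod_add free_mod_smult basis_in_free_mod)
  qed
qed

text \<open>Splitting the support by number of vertices gives the homogeneous components. Membership
  in the filtration thereby becomes a condition on the support.\<close>

lemma filt_RT_eq:
  "filt_RT X \<Omega> n = (free_mod {F \<in> forests_RT X \<Omega>. weight F \<le> n} :: ('a ptree list \<Rightarrow>\<^sub>0 'k::comm_ring_1) set)"
proof -
  have graded: "graded_RT X \<Omega> k = free_mod {F \<in> forests_RT X \<Omega>. weight F = k}" for k
    by (simp only: graded_RT_def span_basis)
  show ?thesis
  proof (intro subset_antisym subsetI)
    fix p :: "'a ptree list \<Rightarrow>\<^sub>0 'k" assume "p \<in> filt_RT X \<Omega> n"
    then obtain h where p: "p = (\<Sum>k\<le>n. h k)" and h: "\<And>k. k \<le> n \<Longrightarrow> h k \<in> graded_RT X \<Omega> k"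
      by (auto simp: filt_RT_def)
    show "p \<in> free_mod {F \<in> forests_RT X \<Omega>. weight F \<le> n}"
      unfolding p
    proof (rule free_mod_sum)
      fix k assume "k \<in> {..n}"
      then show "h k \<in> free_mod {F \<in> forests_RT X \<Omega>. weight F \<le> n}"
        using h[of k] by (auto simp: graded free_mod_def)
    qed
  next
    fix p :: "'a ptree list \<Rightarrow>\<^sub>0 'k" assume p: "p \<in> free_mod {F \<in> forests_RT X \<Omega>. weight F \<le> n}"
    define h where "h k = (\<Sum>F\<in>{F \<in> Poly_Mapping.keys p. weight F = k}.
      Poly_Mapping.lookup p F \<odot> basis F)" for k
    have "p = (\<Sum>k\<le>n. h k)"
      unfolding h_def using p
      by (subst sum.group) (auto simp: free_mod_def simp flip: free_mod_expand)
    moreover have "h k \<in> graded_RT X \<Omega> k" for k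
      unfolding h_def graded using p
      by (intro free_mod_sum free_mod_smult basis_in_free_mod) (auto simp: free_mod_def)
    ultimately show "p \<in> filt_RT X \<Omega> n"
      by (auto simp: filt_RT_def)
  qed
qed

lemma vertices_pos: "0 < vertices T"
  by (cases T) simp

text \<open>Every tree has a vertex. This is the source of connectedness.\<close>

lemma forests_weight_zero: "{F \<in> forests_RT X \<Omega>. weight F \<le> 0} = {[]}"
proof -
  have "F = []" if "weight F = 0" for F :: "'a ptree list"
    using that vertices_pos[of "hd F"] by (cases F) auto
  then show ?thesis by auto
qed

lemma free_mod_Nil: "free_mod {[]} = range (\<lambda>c :: 'k::comm_ring_1. c \<odot> (1 :: 'a ptree list \<Rightarrow>\<^sub>0 'k))"
proof (intro subset_antisym subsetI)
  fix p :: "'a ptree list \<Rightarrow>\<^sub>0 'k" assume "p \<in> free_mod {[]}"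
  then have "lin_ext (\<odot>) basis p = Poly_Mapping.lookup p [] \<odot> basis []"
    using lin_ext_superset[OF module_smult, of "{[]}" p basis] by (simp add: free_mod_def)
  then show "p \<in> range (\<lambda>c. c \<odot> 1)"
    by (auto simp: lin_ext_basis_id one_eq_basis)
next
  fix p assume "p \<in> range (\<lambda>c :: 'k. c \<odot> (1 :: 'a ptree list \<Rightarrow>\<^sub>0 'k))"
  then show "p \<in> free_mod {[]}"
    unfolding one_eq_basis by (auto intro!: free_mod_smult basis_in_free_mod)
qed

lemma comult_RT_eq_lin_ext: "comult_RT X \<mu> lam x = lin_ext (\<odot>) (comult_forest X \<mu> lam) x"
  by (simp add: comult_RT_def)

section \<open>The coalgebra, filtration and bialgebra axioms\<close>

text \<open>All maps are linear extensions, so each law follows by inserting its version for forests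
  under \<open>lin_ext\<close>.\<close>

lemma coalgebra_RT: "coalgebra (forests_RT X \<Omega>) (comult_RT X \<mu> lam) (counit_RT X \<mu> lam)"
proof
  have "comult_forest X \<mu> lam F \<in> free_mod (forests_RT X \<Omega> \<times> forests_RT X \<Omega>)"
    if "F \<in> forests_RT X \<Omega>" for F
    using comult_forest_weight[OF that] by (rule subsetD[OF free_mod_mono, rotated]) auto
  then show "linear_map (\<odot>) (\<odot>) (free_mod (forests_RT X \<Omega>))
      (free_mod (forests_RT X \<Omega> \<times> forests_RT X \<Omega>)) (comult_RT X \<mu> lam)"
    unfolding comult_RT_def by (rule linear_map_lin_ext_into)
  show "linear_map (\<odot>) (*) (free_mod (forests_RT X \<Omega>)) UNIV (counit_RT X \<mu> lam)"
    unfolding counit_RT_def by (rule lin_ext_linear[OF module_mult])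
next
  fix x
  show "tensor_assoc (tensor_map (comult_RT X \<mu> lam) (\<lambda>y. y) (comult_RT X \<mu> lam x)) =
      tensor_map (\<lambda>y. y) (comult_RT X \<mu> lam) (comult_RT X \<mu> lam x)"
    using coassoc_forest[of X \<mu> lam]
    by (simp only: comult_RT_eq_lin_ext[of _ _ _ x] tensor_assoc_def tensor_map_eq
        lin_ext_lin_ext[OF module_smult])
next
  fix x
  show "tensor_lift (\<odot>) (\<lambda>y z. counit_RT X \<mu> lam y \<odot> z) (comult_RT X \<mu> lam x) = x"
    using counit_left_forest[of X \<mu> lam]
    by (simp only: comult_RT_eq_lin_ext[of _ _ _ x] tensor_lift_def
        lin_ext_lin_ext[OF module_smult] lin_ext_basis_id)
next
  fix x
  show "tensor_lift (\<odot>) (\<lambda>y z. counit_RT X \<mu> lam z \<odot> y) (comult_RT X \<mu> lam x) = x"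
    using counit_right_forest[of X \<mu> lam]
    by (simp only: comult_RT_eq_lin_ext[of _ _ _ x] tensor_lift_def
        lin_ext_lin_ext[OF module_smult] lin_ext_basis_id)
qed

lemma comult_RT_filt:
  fixes \<mu> lam :: "'a \<Rightarrow> 'k::comm_ring_1"
  shows "comult_RT X \<mu> lam ` filt_RT X \<Omega> n \<subseteq> module.span (\<odot>)
    (\<Union>(p, q) \<in> {(p, q). p + q = n}. {x \<otimes> y | x y. x \<in> filt_RT X \<Omega> p \<and> y \<in> filt_RT X \<Omega> q})"
    (is "_ \<subseteq> module.span _ ?T")
proof clarify
  fix x :: "'a ptree list \<Rightarrow>\<^sub>0 'k" assume x: "x \<in> filt_RT X \<Omega> n"
  let ?D = "{(G, H). G \<in> forests_RT X \<Omega> \<and> H \<in> forests_RT X \<Omega> \<and> weight G + weight H \<le> n}"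
  have "comult_RT X \<mu> lam x \<in> free_mod ?D"
    unfolding comult_RT_def
  proof (rule lin_ext_closed[OF x[unfolded filt_RT_eq]])
    fix F assume "F \<in> {F \<in> forests_RT X \<Omega>. weight F \<le> n}"
    then show "comult_forest X \<mu> lam F \<in> free_mod ?D"
      by (intro subsetD[OF free_mod_mono comult_forest_weight[of F X \<Omega>]]) auto
  qed
  also have "free_mod ?D = module.span (\<odot>) (basis ` ?D)"
    by (rule span_basis[symmetric])
  also have "\<dots> \<subseteq> module.span (\<odot>) ?T"
  proof (rule module.span_mono[OF module_smult], clarify)
    fix G H assume *: "G \<in> forests_RT X \<Omega>" "H \<in> forests_RT X \<Omega>" "weight G + weight H \<le> n"
    \<comment> \<open>The degrees must add up to exactly \<open>n\<close>, while the vertices may be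
      fewer; the surplus is given to the right factor.\<close>
    then have "basis G \<in> filt_RT X \<Omega> (weight G)" "basis H \<in> filt_RT X \<Omega> (n - weight G)"
      by (auto simp: filt_RT_eq intro!: basis_in_free_mod)
    moreover have "weight G + (n - weight G) = n" using * by simp
    ultimately show "basis (G, H) \<in> ?T"
      unfolding basis_tensor[symmetric] by blast
  qed
  finally show "comult_RT X \<mu> lam x \<in> module.span (\<odot>) ?T" .
qed

lemma counit_RT_smult_one: "counit_RT X \<mu> lam (c \<odot> 1) = c"
  by (simp add: counit_RT_def one_eq_basis smult_single lin_ext_single module_mult)

lemma connected_cofiltered_RT:
  "connected_cofiltered_coaugmented_coalgebra (forests_RT X \<Omega>) (comult_RT X \<mu> lam)
    (counit_RT X \<mu> lam) (\<lambda>c. c \<odot> 1) (filt_RT X \<Omega>)"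
proof -
  interpret coalgebra "forests_RT X \<Omega>" "comult_RT X \<mu> lam" "counit_RT X \<mu> lam"
    by (rule coalgebra_RT)
  show ?thesis
  proof
    show "linear_map (*) (\<odot>) UNIV (free_mod (forests_RT X \<Omega>)) (\<lambda>c. c \<odot> 1)"
      by (auto simp: linear_map_def one_eq_basis module.scale_left_distrib[OF module_smult]
          module.scale_scale[OF module_smult] intro!: free_mod_smult basis_in_free_mod)
    show "counit_RT X \<mu> lam (c \<odot> 1) = c" for c
      by (rule counit_RT_smult_one)
    show "module.subspace (\<odot>) (filt_RT X \<Omega> n)" for n
      by (simp add: filt_RT_eq subspace_free_mod)
    show "filt_RT X \<Omega> n \<subseteq> filt_RT X \<Omega> (Suc n)" for n
      unfolding filt_RT_eq by (rule free_mod_mono) auto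
    show "(\<Union>n. filt_RT X \<Omega> n) = free_mod (forests_RT X \<Omega>)"
    proof (intro subset_antisym subsetI)
      fix p assume p: "p \<in> free_mod (forests_RT X \<Omega>)"
      \<comment> \<open>The sum over the finite support bounds every single weight and also makes
        sense for \<open>p = 0\<close>.\<close>
      have "p \<in> filt_RT X \<Omega> (\<Sum>F\<in>Poly_Mapping.keys p. weight F)"
        using p by (auto simp: filt_RT_eq free_mod_def intro!: member_le_sum)
      then show "p \<in> (\<Union>n. filt_RT X \<Omega> n)" by blast
    qed (auto simp: filt_RT_eq free_mod_def)
    show "range (\<lambda>c. c \<odot> 1) \<subseteq> filt_RT X \<Omega> n" for n
      unfolding filt_RT_eq free_mod_Nil[symmetric] by (rule free_mod_mono) simp
    show "comult_RT X \<mu> lam ` filt_RT X \<Omega> n \<subseteq> module.span (\<odot>)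
        (\<Union>(p, q) \<in> {(p, q). p + q = n}. {x \<otimes> y | x y. x \<in> filt_RT X \<Omega> p \<and> y \<in> filt_RT X \<Omega> q})" for n
      by (rule comult_RT_filt)
    show "filt_RT X \<Omega> 0 = range (\<lambda>c. c \<odot> 1)"
      by (simp only: filt_RT_eq forests_weight_zero free_mod_Nil)
  qed
qed

lemma bialgebra_RT:
  "bialgebra (forests_RT X \<Omega>) (*) 1 (comult_RT X \<mu> lam) (counit_RT X \<mu> lam)"
proof -
  interpret coalgebra "forests_RT X \<Omega>" "comult_RT X \<mu> lam" "counit_RT X \<mu> lam"
    by (rule coalgebra_RT)
  have closed: "x * y \<in> free_mod (forests_RT X \<Omega>)"
    if "x \<in> free_mod (forests_RT X \<Omega>)" "y \<in> free_mod (forests_RT X \<Omega>)"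
    for x y :: "'a ptree list \<Rightarrow>\<^sub>0 'b"
    using that by (rule free_mod_times) (simp add: plus_list_def)
  show ?thesis
  proof
    show "linear_map (\<odot>) (\<odot>) (free_mod (forests_RT X \<Omega>)) (free_mod (forests_RT X \<Omega>)) (\<lambda>x. x * y)"
      and "linear_map (\<odot>) (\<odot>) (free_mod (forests_RT X \<Omega>)) (free_mod (forests_RT X \<Omega>)) ((*) y)"
      if "y \<in> free_mod (forests_RT X \<Omega>)" for y :: "'a ptree list \<Rightarrow>\<^sub>0 'b"
      using that closed
      by (auto simp: linear_map_def distrib_left distrib_right smult_times times_smult)
    show "(1 :: 'a ptree list \<Rightarrow>\<^sub>0 'b) \<in> free_mod (forests_RT X \<Omega>)"
      unfolding one_eq_basis by (intro basis_in_free_mod) simp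
    show "comult_RT X \<mu> lam (x * y) =
        tensor_times (*) (comult_RT X \<mu> lam x) (comult_RT X \<mu> lam y)" for x y
      by (simp add: tensor_times_eq comult_RT_times)
    show "comult_RT X \<mu> lam 1 = 1 \<otimes> 1"
      using comult_RT_basis[of X \<mu> lam "[]"] by (simp add: one_eq_basis)
    show "counit_RT X \<mu> lam 1 = 1"
      using counit_RT_basis[of X \<mu> lam "[]"] by (simp add: one_eq_basis)
  qed (simp_all add: mult.assoc counit_RT_times)
qed

theorem theorem3p11:
  fixes X \<Omega> :: "'a set" and \<mu> lam :: "'a \<Rightarrow> 'k::comm_ring_1"
  assumes "X \<inter> \<Omega> = {}" and "\<Omega> \<noteq> {}"
  shows "connected_cofiltered_coaugmented_coalgebra
           (forests_RT X \<Omega>) (comult_RT X \<mu> lam) (counit_RT X \<mu> lam)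
           (\<lambda>c. c \<odot> 1) (filt_RT X \<Omega>)
       \<and> hopf_algebra (forests_RT X \<Omega>) (*) 1 (comult_RT X \<mu> lam) (counit_RT X \<mu> lam)"
  using connected_cofiltered_RT connected_cofiltered_bialgebra.hopf
    [OF connected_cofiltered_bialgebra.intro[OF bialgebra_RT connected_cofiltered_RT]]
  by blast

end
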